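(* Let $a>0$, $b>0$ be given constants. Consider, for $p>0$ and $\lambda>0$, the problem $$-(b+a\Vert u'\Vert^2)\,u''(x)=\lambda u(x)^p,\ x\in I,\qquad u(x)>0,\ x\in I,\qquad u(\pm1)=0, \qquad ( * )$$ on $I=(-1,1)$, and for a solution $u_\lambda$ write $\xi:=\Vert u_\lambda\Vert_\infty$ . (i) Assume that $p=3$. Let $\lambda>a\mu_1=4aA_3^3B_3$. Then $( * )$ has a unique solution $$u_\lambda(x)=\sqrt{\frac{b\Vert W_3'\Vert^2}{\lambda-a\Vert W_3'\Vert^2}}\;\Vert W_3'\Vert^{-1}W_3(x),$$ where $\Vert W_3'\Vert=2A_3^{3/2}B_3^{1/2}$, and $$\lambda(\xi)=4aA_3^3B_3+2A_3^2\,b\,\xi^{-2}\qquad(\xi>0).$$ (ii) Assume that $p=1$. Let $\lambda>\frac{\pi^2}{4}b$. Then the solution $u_\lambda$ of $( * )$ is given by $$u_\lambda(x)=\frac{4}{\pi^2}\sqrt{\frac{\lambda-(\pi^2b)/4}{a}}\;\cos\frac{\pi}{2}x.$$ Furthermore, $$\lambda(\xi)=\frac{\pi^4}{16}a\xi^2+\frac{\pi^2}{4}b\qquad(\xi>0).$$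
   Context: $I:=(-1,1)$, $\Vert u'\Vert:=\left(\int_I u'(x)^2\,dx\right)^{1/2}$, and $\Vert\cdot\Vert_\infty$ is the maximum norm on $\bar I$. Solutions are classical, i.e. $u\in C^2(\bar I)$. The notation $\lambda(\xi)$ means that $\lambda$ is expressed as a function of the maximum norm $\xi=\Vert u_\lambda\Vert_\infty$ of the corresponding solution. The constants are $$A_3:=\int_0^1\frac{1}{\sqrt{1-s^4}}\,ds,\qquad B_3:=\int_0^1\sqrt{1-s^4}\,ds.$$ In (i), $\mu_1:=\inf\left\{\Vert u'\Vert^{4}:\ u\in H_0^1(I),\ \int_I u(x)^{4}\,dx=1\right\}$. $W_3$ denotes the unique solution (known to exist and be unique) of $-W''(x)=W(x)^3$ and $W(x)>0$ for $x\in I$, $W(-1)=W(1)=0$. *)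

theory Defs
  imports "HOL-Analysis.Analysis"
begin

abbreviation II :: "real set" where "II \<equiv> {-1<..<1}"

abbreviation II_closed :: "real set" where "II_closed \<equiv> {-1..1}"

definition L2 :: "(real \<Rightarrow> real) set" where
  "L2 = {f. f \<in> borel_measurable (lebesgue_on II) \<and> integrable (lebesgue_on II) (\<lambda>x. (f x)\<^sup>2)}"

definition L2norm :: "(real \<Rightarrow> real) \<Rightarrow> real" where
  "L2norm f = sqrt (integral\<^sup>L (lebesgue_on II) (\<lambda>x. (f x)\<^sup>2))"

definition maxnorm :: "(real \<Rightarrow> real) \<Rightarrow> real" where
  "maxnorm u = (SUP x\<in>II_closed. \<bar>u x\<bar>)"

text \<open>Functions live on the whole real line, but only their values on the closed interval
  matter; derivatives at the end points are one-sided.\<close>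

definition C2_closed :: "(real \<Rightarrow> real) \<Rightarrow> bool" where
  "C2_closed u \<longleftrightarrow> (\<exists>u' u''.
     (\<forall>x\<in>II_closed. (u has_real_derivative u' x) (at x within II_closed)) \<and>
     (\<forall>x\<in>II_closed. (u' has_real_derivative u'' x) (at x within II_closed)) \<and>
     continuous_on II_closed u'')"

definition kirchhoff_solution ::
    "real \<Rightarrow> real \<Rightarrow> real \<Rightarrow> real \<Rightarrow> (real \<Rightarrow> real) \<Rightarrow> bool" where
  "kirchhoff_solution a b p lam u \<longleftrightarrow>
     C2_closed u \<and>
     (\<forall>x\<in>II. - (b + a * (L2norm (deriv u))\<^sup>2) * deriv (deriv u) x = lam * u x powr p) \<and>
     (\<forall>x\<in>II. u x > 0) \<and>
     u (-1) = 0 \<and> u 1 = 0"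

definition W3_problem :: "(real \<Rightarrow> real) \<Rightarrow> bool" where
  "W3_problem W \<longleftrightarrow>
     C2_closed W \<and>
     (\<forall>x\<in>II. - deriv (deriv W) x = W x ^ 3) \<and>
     (\<forall>x\<in>II. W x > 0) \<and>
     W (-1) = 0 \<and> W 1 = 0"

text \<open>The solution is unique as a function on the closed interval; setting it to zero
  elsewhere makes it unique as a function on the real line.\<close>

definition W3 :: "real \<Rightarrow> real" where
  "W3 = (THE W. W3_problem W \<and> (\<forall>x. x \<notin> II_closed \<longrightarrow> W x = 0))"

text \<open>The singularity of the first integrand at \<open>s = 1\<close> is harmless: there the integrand
  is \<open>1 / 0 = 0\<close>, and the Henstock--Kurzweil integral agrees with the improper one.\<close>

definition A3 :: real where
  "A3 = integral {0..1} (\<lambda>s. 1 / sqrt (1 - s ^ 4))"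

definition B3 :: real where
  "B3 = integral {0..1} (\<lambda>s. sqrt (1 - s ^ 4))"

text \<open>The space of smooth functions with compact support in the open interval.\<close>

definition test_functions :: "(real \<Rightarrow> real) set" where
  "test_functions = {\<phi>. (\<forall>k x. (deriv ^^ k) \<phi> differentiable at x) \<and>
     (\<exists>K. compact K \<and> K \<subseteq> II \<and> (\<forall>x. x \<notin> K \<longrightarrow> \<phi> x = 0))}"

text \<open>\<open>u\<close> belongs to the Sobolev space \<open>H\<^sup>1\<close> of the open interval, with weak derivative \<open>g\<close>
  (which is unique up to null sets).\<close>

definition has_weak_deriv :: "(real \<Rightarrow> real) \<Rightarrow> (real \<Rightarrow> real) \<Rightarrow> bool" where
  "has_weak_deriv u g \<longleftrightarrow> u \<in> L2 \<and> g \<in> L2 \<and>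
     (\<forall>\<phi>\<in>test_functions. integral\<^sup>L (lebesgue_on II) (\<lambda>x. u x * deriv \<phi> x) =
                     - integral\<^sup>L (lebesgue_on II) (\<lambda>x. g x * \<phi> x))"

text \<open>The closure of the test functions with respect to the \<open>H\<^sup>1\<close> norm.\<close>

definition H01 :: "(real \<Rightarrow> real) set" where
  "H01 = {u. \<exists>g. has_weak_deriv u g \<and>
     (\<forall>\<epsilon>>0. \<exists>\<phi>\<in>test_functions.
        sqrt ((L2norm (\<lambda>x. u x - \<phi> x))\<^sup>2 + (L2norm (\<lambda>x. g x - deriv \<phi> x))\<^sup>2) < \<epsilon>)}"

definition mu1 :: real where
  "mu1 = Inf {L2norm g ^ 4 |u g. u \<in> H01 \<and> has_weak_deriv u g \<and>
                integral\<^sup>L (lebesgue_on II) (\<lambda>x. u x ^ 4) = 1}"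

end

(* The scalar Kirchhoff coefficient b + a |u'|^2 is a constant, so every solution is a multiple of
   the solution W of the local problem, and the multiple is fixed by one algebraic equation.

   For p = 3 the local problem is solved by the lemniscate sine sl, which satisfies
   sl'' = -2 sl^3 and sl'^2 = 1 - sl^4; W(x) = sqrt 2 A sl (A (x + 1)) with A = A3. Any positive
   solution has the same initial data at -1 as some k sqrt 2 sl (k (x + 1)), hence agrees with it,
   and the boundary condition at 1 forces k = A. Since (sl sl')' = 1 - 3 sl^4, the integrals of
   W^4 and W'^2 agree with 4 A3^3 B3, where 3 B3 = 2 A3.

   The sharp constant mu1 is obtained by calibration: if f vanishes at -1 and 1 and has maximal
   modulus 1, integrating f'^2 + A^2 (1 - f^4) >= 2 A |f'| sqrt (1 - f^4) separately on both sides
   of a maximum point gives P >= A^2 (Q + 2/3) for P, Q the integrals of f'^2 and f^4. Rescaling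
   and the arithmetic-geometric mean inequality yield P^2 >= 4 A3^3 B3 Q, which passes to H01 by
   density. Conversely W is approximated by smooth compactly supported truncations whose
   derivatives are dominated by |W'|. *)

theory Submission imports Defs begin

section \<open>The lemniscate sine\<close>

text \<open>Write A, B for \<open>A3\<close>, \<open>B3\<close>. The number 4 A^3 B is the common
  value of P and Q at W, hence also the value of P^2 / Q there. The calibration loses nothing at the
  minimizer: f = sl (A (x + 1)) satisfies |f'| = A sqrt (1 - f^4), the equality case of the
  pointwise estimate. With m the maximum of f^2, rescaling turns the normalized inequality into P >=
  A^2 (Q / m + 2 m / 3). The product of the two summands is free of m, so the arithmetic-geometric
  mean inequality removes m. Dropping Q instead bounds the maximum norm by P; this is the domination
  that the density argument needs, since closeness in L2 alone does not control the integral of u^4.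
  Two obstacles shape the rest. The function inverse to the integral of 1 / sqrt (1 - s^4) stops at
  its maximum, so the inversion is done in the angle variable, where nothing has to be glued. And
  the weak derivative in \<open>mu1\<close> is not the one chosen in \<open>H01\<close>, so the
  norms of the two have to be compared.\<close>

text \<open>The substitution \<open>s = sin \<theta>\<close> turns the singular integrand \<open>1 / sqrt (1 - s^4)\<close> into
  \<open>1 / sqrt (1 + sin\<^sup>2 \<theta>)\<close>, so that the inverse function is defined and smooth on the whole line.\<close>

definition ell_F :: "real \<Rightarrow> real" where
  "ell_F = (SOME F. F 0 = 0 \<and> (\<forall>\<theta>. (F has_real_derivative 1 / sqrt (1 + (sin \<theta>)\<^sup>2)) (at \<theta>)))"

lemma one_plus_sin_pos: "0 < 1 + (sin (\<theta>::real))\<^sup>2"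
  by (simp add: add_pos_nonneg)

lemma ell_F: "ell_F 0 = 0" "(ell_F has_real_derivative 1 / sqrt (1 + (sin \<theta>)\<^sup>2)) (at \<theta>)"
proof -
  have "isCont (\<lambda>\<theta>. 1 / sqrt (1 + (sin \<theta>)\<^sup>2)) x" for x :: real
    using one_plus_sin_pos[of x] by (intro continuous_intros) auto
  then have "\<exists>F. \<forall>x. -\<infinity> < ereal x \<longrightarrow> ereal x < \<infinity> \<longrightarrow>
      (F has_vector_derivative 1 / sqrt (1 + (sin x)\<^sup>2)) (at x)"
    by (intro einterval_antiderivative) auto
  then obtain F where "\<And>x. (F has_real_derivative 1 / sqrt (1 + (sin x)\<^sup>2)) (at x)"
    by (auto simp: has_real_derivative_iff_has_vector_derivative)
  then have "(\<lambda>x. F x - F 0) 0 = 0 \<and>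
      (\<forall>\<theta>. ((\<lambda>x. F x - F 0) has_real_derivative 1 / sqrt (1 + (sin \<theta>)\<^sup>2)) (at \<theta>))"
    by (auto intro!: derivative_eq_intros)
  then have "ell_F 0 = 0 \<and> (\<forall>\<theta>. (ell_F has_real_derivative 1 / sqrt (1 + (sin \<theta>)\<^sup>2)) (at \<theta>))"
    unfolding ell_F_def
    by (rule someI[where P = "\<lambda>F. F 0 = 0 \<and>
      (\<forall>\<theta>. (F has_real_derivative 1 / sqrt (1 + (sin \<theta>)\<^sup>2)) (at \<theta>))"])
  then show "ell_F 0 = 0" "(ell_F has_real_derivative 1 / sqrt (1 + (sin \<theta>)\<^sup>2)) (at \<theta>)" by auto
qed

lemma isCont_ell_F: "isCont ell_F x"
  using ell_F(2) DERIV_isCont by blast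

lemma strict_mono_ell_F: "strict_mono ell_F"
proof (rule strict_monoI)
  fix x y :: real assume "x < y"
  then show "ell_F x < ell_F y"
    by (rule DERIV_pos_imp_increasing) (use ell_F(2) one_plus_sin_pos in fastforce)
qed

text \<open>Since 1 + sin^2 is at most 4, the integrand is at least 1/2. This linear growth is what
  makes \<open>ell_F\<close> onto, so that its inverse lives on the whole line.\<close>

lemma ell_F_growth: "x \<le> y \<Longrightarrow> (y - x) / 2 \<le> ell_F y - ell_F x"
proof -
  assume "x \<le> y"
  have "(\<lambda>t. ell_F t - t / 2) x \<le> (\<lambda>t. ell_F t - t / 2) y"
  proof (rule DERIV_nonneg_imp_nondecreasing[OF \<open>x \<le> y\<close>])
    fix t
    have "sqrt (1 + (sin t)\<^sup>2) \<le> sqrt (2\<^sup>2)"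
      using abs_sin_le_one[of t] abs_square_le_1[of "sin t"] by (intro real_sqrt_le_mono) auto
    then have "1 / sqrt (1 + (sin t)\<^sup>2) - 1 / 2 \<ge> 0"
      using one_plus_sin_pos[of t] by (simp add: field_simps)
    moreover have "((\<lambda>t. ell_F t - t / 2) has_real_derivative 1 / sqrt (1 + (sin t)\<^sup>2) - 1 / 2) (at t)"
      by (auto intro!: derivative_eq_intros ell_F(2))
    ultimately show "\<exists>y. ((\<lambda>t. ell_F t - t / 2) has_real_derivative y) (at t) \<and> 0 \<le> y" by blast
  qed
  then show ?thesis by (simp add: diff_divide_distrib)
qed

lemma bij_ell_F: "bij ell_F"
proof (rule bijI)
  show "inj ell_F" using strict_mono_ell_F by (rule strict_mono_imp_inj_on)
  have "\<exists>x. ell_F x = y" for y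
  proof -
    have "- 2 * \<bar>y\<bar> \<le> 2 * \<bar>y\<bar>" by simp
    moreover have "ell_F (- 2 * \<bar>y\<bar>) \<le> y" "y \<le> ell_F (2 * \<bar>y\<bar>)"
      using ell_F_growth[of 0 "2 * \<bar>y\<bar>"] ell_F_growth[of "- 2 * \<bar>y\<bar>" 0] ell_F(1) by auto
    ultimately show ?thesis
      using IVT[of ell_F "- 2 * \<bar>y\<bar>" y "2 * \<bar>y\<bar>"] isCont_ell_F by blast
  qed
  then show "surj ell_F" by (metis surjI)
qed

text \<open>The Jacobi amplitude of parameter -1: the inverse of the incomplete elliptic integral of
  the first kind.\<close>

definition am :: "real \<Rightarrow> real" where "am = inv ell_F"

lemma am_ell_F [simp]: "am (ell_F x) = x"
  unfolding am_def using bij_ell_F by (simp add: bij_is_inj)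

lemma ell_F_am [simp]: "ell_F (am x) = x"
  unfolding am_def using bij_ell_F by (simp add: bij_is_surj surj_f_inv_f)

lemma strict_mono_am: "strict_mono am"
  by (metis ell_F_am strict_monoI strict_mono_ell_F strict_mono_less)

lemma am_0 [simp]: "am 0 = 0"
  using am_ell_F[of 0] ell_F(1) by simp

lemma DERIV_am: "(am has_real_derivative sqrt (1 + (sin (am x))\<^sup>2)) (at x)"
proof -
  have "isCont am (ell_F (am x))"
    by (rule isCont_inverse_function[where d = 1]) (auto simp: isCont_ell_F)
  then have "isCont am x" by simp
  then have "(am has_real_derivative inverse (1 / sqrt (1 + (sin (am x))\<^sup>2))) (at x)"
    using one_plus_sin_pos[of "am x"]
    by (intro DERIV_inverse_function[where f = ell_F and a = "x - 1" and b = "x + 1"] ell_F(2)) auto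
  then show ?thesis by simp
qed

definition sl :: "real \<Rightarrow> real" where "sl x = sin (am x)"

text \<open>The cosine carries the sign of the derivative beyond the maximum of \<open>sl\<close>,
  which the form sqrt (1 - sl^4) would lose.\<close>

definition sl' :: "real \<Rightarrow> real" where "sl' x = cos (am x) * sqrt (1 + (sl x)\<^sup>2)"

lemma DERIV_sl: "(sl has_real_derivative sl' x) (at x)"
  unfolding sl_def[abs_def] sl'_def
  by (auto intro!: derivative_eq_intros DERIV_am)

lemma DERIV_sl': "(sl' has_real_derivative - 2 * sl x ^ 3) (at x)"
proof -
  have "(sl' has_real_derivative
      - sin (am x) * sqrt (1 + (sl x)\<^sup>2) * sqrt (1 + (sl x)\<^sup>2)
      + cos (am x) * ((2 * sl x * sl' x) / (2 * sqrt (1 + (sl x)\<^sup>2)))) (at x)"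
    unfolding sl'_def[abs_def]
    using one_plus_sin_pos[of "am x"]
    apply (auto intro!: derivative_eq_intros DERIV_am DERIV_sl simp: sl_def[symmetric])
    apply (simp add: sl'_def sl_def field_simps)
    done
  moreover have "- sin (am x) * sqrt (1 + (sl x)\<^sup>2) * sqrt (1 + (sl x)\<^sup>2)
      + cos (am x) * ((2 * sl x * sl' x) / (2 * sqrt (1 + (sl x)\<^sup>2))) = - 2 * sl x ^ 3"
  \<comment> \<open>With s = \<open>sl x\<close> the two summands are - s (1 + s^2) and (1 - s^2)
    s.\<close>
  proof -
    have p: "0 < 1 + (sl x)\<^sup>2" using one_plus_sin_pos[of "am x"] by (simp add: sl_def)
    have "cos (am x) * ((2 * sl x * sl' x) / (2 * sqrt (1 + (sl x)\<^sup>2))) = (cos (am x))\<^sup>2 * sl x"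
      using p by (simp add: sl'_def power2_eq_square)
    moreover have "- sin (am x) * sqrt (1 + (sl x)\<^sup>2) * sqrt (1 + (sl x)\<^sup>2) = - sl x * (1 + (sl x)\<^sup>2)"
      using p by (simp add: sl_def)
    moreover have "(cos (am x))\<^sup>2 = 1 - (sl x)\<^sup>2" by (simp add: sl_def cos_squared_eq)
    ultimately have "- sin (am x) * sqrt (1 + (sl x)\<^sup>2) * sqrt (1 + (sl x)\<^sup>2)
      + cos (am x) * ((2 * sl x * sl' x) / (2 * sqrt (1 + (sl x)\<^sup>2)))
      = - sl x * (1 + (sl x)\<^sup>2) + (1 - (sl x)\<^sup>2) * sl x" by simp
    then show ?thesis by (simp add: algebra_simps power2_eq_square power3_eq_cube)
  qed
  ultimately show ?thesis by simp
qed

lemma sl'_squared: "(sl' x)\<^sup>2 = 1 - sl x ^ 4"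
proof -
  have "(sl' x)\<^sup>2 = (cos (am x))\<^sup>2 * (1 + (sl x)\<^sup>2)"
    using one_plus_sin_pos[of "am x"] by (simp add: sl'_def sl_def power_mult_distrib)
  also have "(cos (am x))\<^sup>2 = 1 - (sl x)\<^sup>2" by (simp add: sl_def cos_squared_eq)
  finally show ?thesis by (simp add: algebra_simps power2_eq_square power4_eq_xxxx)
qed

lemma abs_sl_le_1: "\<bar>sl x\<bar> \<le> 1"
  by (simp add: sl_def)

lemma sl_0 [simp]: "sl 0 = 0" and sl'_0 [simp]: "sl' 0 = 1"
  by (auto simp: sl_def sl'_def)

text \<open>The antiderivative is \<open>ell_F (arcsin s)\<close>, by 1 - s^4 = (1 + s^2) (1 - s^2).
  It is continuous up to s = 1, and differentiability is asked only in the open interval, so the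
  singular end point causes no trouble.\<close>

lemma has_integral_A3: "((\<lambda>s. 1 / sqrt (1 - s ^ 4)) has_integral ell_F (pi / 2)) {0..1}"
proof -
  have "((\<lambda>s. 1 / sqrt (1 - s ^ 4)) has_integral ell_F (arcsin 1) - ell_F (arcsin 0)) {0..1::real}"
  proof (rule fundamental_theorem_of_calculus_interior)
    show "continuous_on {0..1} (\<lambda>s. ell_F (arcsin s))"
      by (rule continuous_on_compose2[where g = ell_F and t = UNIV])
        (auto simp: isCont_ell_F continuous_at_imp_continuous_on intro!: continuous_intros)
    fix s :: real assume s: "s \<in> {0<..<1}"
    have s2: "s\<^sup>2 < 1" using s by (simp add: abs_square_less_1)
    have "((\<lambda>s. ell_F (arcsin s)) has_real_derivative
        1 / sqrt (1 + (sin (arcsin s))\<^sup>2) * inverse (sqrt (1 - s\<^sup>2))) (at s)"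
      by (rule DERIV_chain2[OF ell_F(2) DERIV_arcsin]) (use s in auto)
    moreover have "1 / sqrt (1 + (sin (arcsin s))\<^sup>2) * inverse (sqrt (1 - s\<^sup>2)) = 1 / sqrt (1 - s ^ 4)"
    proof -
      have "1 - s ^ 4 = (1 + s\<^sup>2) * (1 - s\<^sup>2)" by (simp add: algebra_simps power2_eq_square power4_eq_xxxx)
      then have "sqrt (1 - s ^ 4) = sqrt (1 + s\<^sup>2) * sqrt (1 - s\<^sup>2)" by (simp only: real_sqrt_mult)
      then show ?thesis using s by (simp add: field_simps)
    qed
    ultimately show "((\<lambda>s. ell_F (arcsin s)) has_vector_derivative 1 / sqrt (1 - s ^ 4)) (at s)"
      by (simp add: has_real_derivative_iff_has_vector_derivative)
  qed auto
  then show ?thesis by (simp add: ell_F(1))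
qed

lemma A3_eq: "A3 = ell_F (pi / 2)"
  unfolding A3_def using has_integral_A3 by (rule integral_unique)

lemma A3_pos: "0 < A3"
  using strict_monoD[OF strict_mono_ell_F, of 0 "pi / 2"] by (simp add: A3_eq ell_F(1))

text \<open>The integrand is symmetric about pi / 2, so
  \<open>ell_F (pi - \<theta>) + ell_F \<theta>\<close> is constant; its values at 0 and pi / 2 are
  compared.\<close>

lemma ell_F_pi: "ell_F pi = 2 * A3"
proof -
  have "\<forall>x. ((\<lambda>\<theta>. ell_F (pi - \<theta>) + ell_F \<theta>) has_real_derivative 0) (at x)"
  proof
    fix x
    have "((\<lambda>\<theta>. ell_F (pi - \<theta>)) has_real_derivative 1 / sqrt (1 + (sin (pi - x))\<^sup>2) * (- 1)) (at x)"
      by (rule DERIV_chain2[OF ell_F(2)]) (auto intro!: derivative_eq_intros)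
    then show "((\<lambda>\<theta>. ell_F (pi - \<theta>) + ell_F \<theta>) has_real_derivative 0) (at x)"
      using DERIV_add[OF _ ell_F(2)[of x]] by fastforce
  qed
  from DERIV_isconst_all[OF this, of 0 "pi / 2"] show ?thesis
    by (simp add: A3_eq ell_F(1))
qed

lemma sl_A3: "sl A3 = 1" and sl_2A3: "sl (2 * A3) = 0"
  by (simp_all add: sl_def A3_eq flip: ell_F_pi) (simp add: ell_F_pi[symmetric, unfolded A3_eq])

lemma sl_pos: "sl x > 0" if "0 < x" "x < 2 * A3"
proof -
  have "am 0 < am x" "am x < am (ell_F pi)"
    using that strict_mono_am by (auto simp: ell_F_pi strict_mono_less simp del: am_0 am_ell_F)
  then show ?thesis by (auto simp: sl_def intro: sin_gt_zero)
qed

text \<open>The integrand is the derivative of s sqrt (1 - s^4), which vanishes at both ends. This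
  is the source of the relation between \<open>A3\<close> and \<open>B3\<close>.\<close>

lemma has_integral_3B3: "((\<lambda>s. 3 * sqrt (1 - s ^ 4) - 2 * (1 / sqrt (1 - s ^ 4))) has_integral 0) {0..1::real}"
proof -
  have "((\<lambda>s. 3 * sqrt (1 - s ^ 4) - 2 * (1 / sqrt (1 - s ^ 4))) has_integral
      1 * sqrt (1 - 1 ^ 4) - 0 * sqrt (1 - 0 ^ 4)) {0..1::real}"
  proof (rule fundamental_theorem_of_calculus_interior)
    show "continuous_on {0..1::real} (\<lambda>s. s * sqrt (1 - s ^ 4))"
      by (intro continuous_intros)
    fix s :: real assume s: "s \<in> {0<..<1}"
    have p: "0 < 1 - s ^ 4" using s by (simp add: power_less_one_iff)
    have "((\<lambda>s. s * sqrt (1 - s ^ 4)) has_real_derivative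
        sqrt (1 - s ^ 4) + s * ((- 4 * s ^ 3) / (2 * sqrt (1 - s ^ 4)))) (at s)"
      using p by (auto intro!: derivative_eq_intros simp: field_simps)
    moreover have "sqrt (1 - s ^ 4) + s * ((- 4 * s ^ 3) / (2 * sqrt (1 - s ^ 4)))
        = 3 * sqrt (1 - s ^ 4) - 2 * (1 / sqrt (1 - s ^ 4))"
    proof -
      have "sqrt (1 - s ^ 4) * sqrt (1 - s ^ 4) = 1 - s ^ 4" using p by simp
      then show ?thesis using p by (simp add: field_simps power4_eq_xxxx power3_eq_cube)
    qed
    ultimately have "((\<lambda>s. s * sqrt (1 - s ^ 4)) has_real_derivative
        3 * sqrt (1 - s ^ 4) - 2 * (1 / sqrt (1 - s ^ 4))) (at s)" by (rule back_subst)
    then show "((\<lambda>s. s * sqrt (1 - s ^ 4)) has_vector_derivative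
        3 * sqrt (1 - s ^ 4) - 2 * (1 / sqrt (1 - s ^ 4))) (at s)"
      by (simp add: has_real_derivative_iff_has_vector_derivative)
  qed auto
  then show ?thesis by simp
qed

lemma B3_eq: "3 * B3 = 2 * A3"
proof -
  have B: "(\<lambda>s. sqrt (1 - s ^ 4)) integrable_on {0..1::real}"
    by (intro integrable_continuous_real continuous_intros)
  have "((\<lambda>s. 3 * sqrt (1 - s ^ 4) - 2 * (1 / sqrt (1 - s ^ 4))) has_integral 3 * B3 - 2 * A3) {0..1::real}"
    unfolding B3_def A3_def
    using B has_integral_A3
    by (intro has_integral_diff has_integral_mult_right integrable_integral) auto
  then have "3 * B3 - 2 * A3 = 0" using has_integral_3B3 by (rule has_integral_unique)
  then show ?thesis by simp
qed

section \<open>Uniqueness for the boundary value problems\<close>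

text \<open>The energy d^2 + d'^2 grows at most at rate 1 + L, so its product with exp (- (1 + L) (x
  - a)) is nonincreasing, and it starts at 0. Applied to the difference of two solutions, this gives
  uniqueness for the cubic and the linear equation alike. The bound on \<open>d''\<close> is asked
  only in the open interval, where the equations hold.\<close>

lemma second_order_gronwall:
  fixes d d' d'' :: "real \<Rightarrow> real"
  assumes d: "\<And>x. x \<in> {a..b} \<Longrightarrow> (d has_real_derivative d' x) (at x within {a..b})"
    and d': "\<And>x. x \<in> {a..b} \<Longrightarrow> (d' has_real_derivative d'' x) (at x within {a..b})"
    and bound: "\<And>x. x \<in> {a<..<b} \<Longrightarrow> \<bar>d'' x\<bar> \<le> L * \<bar>d x\<bar>" and "0 \<le> L"
    and init: "d a = 0" "d' a = 0"
    and x: "x \<in> {a..b}"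
  shows "d x = 0"
proof -
  define e where "e t = ((d t)\<^sup>2 + (d' t)\<^sup>2) * exp (- ((1 + L) * (t - a)))" for t
  have sub: "{a..x} \<subseteq> {a..b}" using x by auto
  have cont: "continuous_on {a..x} d" "continuous_on {a..x} d'"
    using DERIV_continuous_on[OF d] DERIV_continuous_on[OF d'] continuous_on_subset[OF _ sub]
    by blast+
  have "e x \<le> e a"
  proof (rule DERIV_nonpos_imp_decreasing_open[where f = e])
    show "a \<le> x" using x by simp
    show "continuous_on {a..x} e"
      unfolding e_def[abs_def] by (intro continuous_intros cont)
    fix t assume t: "a < t" "t < x"
    then have tb: "t \<in> {a<..<b}" using x by auto
    have D: "(d has_real_derivative d' t) (at t)" "(d' has_real_derivative d'' t) (at t)"
      using d[of t] d'[of t] tb by (auto simp: at_within_Icc_at)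
    let ?D = "(2 * d t * d' t + 2 * d' t * d'' t - (1 + L) * ((d t)\<^sup>2 + (d' t)\<^sup>2))
      * exp (- ((1 + L) * (t - a)))"
    have "(e has_real_derivative ?D) (at t)"
      unfolding e_def[abs_def] by (auto intro!: derivative_eq_intros D simp: algebra_simps)
    moreover have "?D \<le> 0"
    proof -
      have "2 * (d' t * d'' t) \<le> 2 * (\<bar>d' t\<bar> * \<bar>d'' t\<bar>)"
        by (simp add: abs_mult[symmetric])
      also have "\<dots> \<le> 2 * (\<bar>d' t\<bar> * (L * \<bar>d t\<bar>))"
        using bound[OF tb] by (simp add: mult_left_mono)
      finally have "2 * (d t * d' t) + 2 * (d' t * d'' t)
          \<le> 2 * (\<bar>d t\<bar> * \<bar>d' t\<bar>) + 2 * (\<bar>d' t\<bar> * (L * \<bar>d t\<bar>))"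
        using abs_ge_self[of "d t * d' t"] by (simp add: abs_mult)
      also have "\<dots> = (1 + L) * (2 * \<bar>d t\<bar> * \<bar>d' t\<bar>)" by (simp add: algebra_simps)
      also have "\<dots> \<le> (1 + L) * ((d t)\<^sup>2 + (d' t)\<^sup>2)"
        using sum_squares_bound[of "\<bar>d t\<bar>" "\<bar>d' t\<bar>"] \<open>0 \<le> L\<close>
        by (intro mult_left_mono) auto
      finally show ?thesis by (intro mult_nonpos_nonneg) auto
    qed
    ultimately show "\<exists>y. (e has_real_derivative y) (at t) \<and> y \<le> 0" by blast
  qed
  then have "((d x)\<^sup>2 + (d' x)\<^sup>2) * exp (- ((1 + L) * (x - a))) \<le> 0" by (simp add: e_def init)
  then have "(d x)\<^sup>2 + (d' x)\<^sup>2 \<le> 0" by (simp add: mult_le_0_iff)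
  then show ?thesis by (simp add: sum_power2_le_zero_iff)
qed

section \<open>From Lebesgue integrals and \<open>deriv\<close> on the open interval to calculus on
  the closed one\<close>

lemma integrable_II:
  fixes f :: "real \<Rightarrow> real"
  assumes "continuous_on II_closed f"
  shows "integrable (lebesgue_on II) f"
proof -
  have "set_integrable lebesgue II_closed f"
    using assms by (rule absolutely_integrable_continuous_real)
  then have "set_integrable lebesgue II f"
    by (rule set_integrable_subset) auto
  then show ?thesis
    by (simp add: set_integrable_def integrable_restrict_space)
qed

lemma integral_II:
  fixes f :: "real \<Rightarrow> real"
  assumes "continuous_on II_closed f"
  shows "integral\<^sup>L (lebesgue_on II) f = integral II_closed f"
proof -
  have "integral\<^sup>L (lebesgue_on II) f = integral II f"
    by (rule lebesgue_integral_eq_integral[OF integrable_II[OF assms]]) auto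
  also have "\<dots> = integral II_closed f"
    using integral_open_interval_real by metis
  finally show ?thesis .
qed

lemma L2norm_squared: "(L2norm f)\<^sup>2 = integral\<^sup>L (lebesgue_on II) (\<lambda>x. (f x)\<^sup>2)"
  unfolding L2norm_def by (rule real_sqrt_pow2) simp

lemma L2norm_squared_eq:
  assumes "\<And>x. x \<in> II \<Longrightarrow> f x = g x" "continuous_on II_closed g"
  shows "(L2norm f)\<^sup>2 = integral II_closed (\<lambda>x. (g x)\<^sup>2)"
proof -
  have "(L2norm f)\<^sup>2 = integral\<^sup>L (lebesgue_on II) (\<lambda>x. (g x)\<^sup>2)"
    unfolding L2norm_squared by (rule Bochner_Integration.integral_cong) (auto simp: assms(1))
  also have "\<dots> = integral II_closed (\<lambda>x. (g x)\<^sup>2)"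
    by (intro integral_II continuous_intros assms)
  finally show ?thesis .
qed

lemma deriv_eq_II:
  assumes "\<And>x. x \<in> II_closed \<Longrightarrow> (u has_real_derivative u' x) (at x within II_closed)"
    and "x \<in> II"
  shows "deriv u x = u' x"
  using assms(1)[of x] assms(2) by (auto simp: at_within_Icc_at intro!: DERIV_imp_deriv)

lemma deriv_cong_II:
  assumes "\<And>x. x \<in> II \<Longrightarrow> f x = g x" "x \<in> II"
  shows "deriv f x = deriv g x"
  by (rule deriv_cong_ev) (use assms in \<open>auto simp: eventually_nhds intro!: exI[of _ II]\<close>)

text \<open>The smoothness condition uses one-sided derivatives at the end points, the equations use
  \<open>deriv\<close>. The two agree in the open interval; at the end points \<open>deriv\<close>
  would depend on values outside.\<close>

lemma C2_closedE:
  assumes "C2_closed u"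
  obtains u' u'' where
    "\<And>x. x \<in> II_closed \<Longrightarrow> (u has_real_derivative u' x) (at x within II_closed)"
    "\<And>x. x \<in> II_closed \<Longrightarrow> (u' has_real_derivative u'' x) (at x within II_closed)"
    "\<And>x. x \<in> II \<Longrightarrow> deriv u x = u' x" "\<And>x. x \<in> II \<Longrightarrow> deriv (deriv u) x = u'' x"
    "continuous_on II_closed u" "continuous_on II_closed u'" "continuous_on II_closed u''"
proof -
  obtain u' u'' where *:
    "\<And>x. x \<in> II_closed \<Longrightarrow> (u has_real_derivative u' x) (at x within II_closed)"
    "\<And>x. x \<in> II_closed \<Longrightarrow> (u' has_real_derivative u'' x) (at x within II_closed)"
    "continuous_on II_closed u''"
    using assms unfolding C2_closed_def by blast
  have 1: "deriv u x = u' x" if "x \<in> II" for x using deriv_eq_II *(1) that by blast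
  have "deriv (deriv u) x = u'' x" if "x \<in> II" for x
    using deriv_cong_II[of "deriv u" u', OF 1 that] deriv_eq_II[OF *(2) that] by simp
  with 1 * show ?thesis by (intro that[of u' u'']) (blast intro: DERIV_continuous_on)+
qed

lemma C2_closedI:
  assumes "\<And>x. x \<in> II_closed \<Longrightarrow> v x = u x"
    and "\<And>x. x \<in> II_closed \<Longrightarrow> (u has_real_derivative u' x) (at x within II_closed)"
    and "\<And>x. x \<in> II_closed \<Longrightarrow> (u' has_real_derivative u'' x) (at x within II_closed)"
    and "continuous_on II_closed u''"
  shows "C2_closed v" "\<And>x. x \<in> II \<Longrightarrow> deriv v x = u' x" "\<And>x. x \<in> II \<Longrightarrow> deriv (deriv v) x = u'' x"
proof -
  have v: "(v has_real_derivative u' x) (at x within II_closed)" if "x \<in> II_closed" for x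
    using assms(2)[OF that] zero_less_one that assms(1)[symmetric]
    by (rule has_field_derivative_transform_within)
  show "C2_closed v" unfolding C2_closed_def using v assms(3,4) by blast
  show 1: "deriv v x = u' x" if "x \<in> II" for x using deriv_eq_II[OF v that] .
  show "deriv (deriv v) x = u'' x" if "x \<in> II" for x
    using deriv_cong_II[of "deriv v" u', OF 1 that] deriv_eq_II[OF assms(3) that] by simp
qed

lemma maxnorm_eqI:
  assumes "\<And>x. x \<in> II_closed \<Longrightarrow> \<bar>u x\<bar> \<le> m" "x0 \<in> II_closed" "\<bar>u x0\<bar> = m"
  shows "maxnorm u = m"
  unfolding maxnorm_def
proof (rule antisym)
  show "(SUP x\<in>II_closed. \<bar>u x\<bar>) \<le> m" using assms by (intro cSUP_least) auto
  show "m \<le> (SUP x\<in>II_closed. \<bar>u x\<bar>)"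
    using assms by (intro cSUP_upper2[where x = x0]) (auto intro!: bdd_aboveI2[where M = m])
qed

section \<open>The cubic local problem and its solution\<close>

text \<open>The scaling family of solutions of W'' = - W^3 that vanish at -1; their slopes sqrt 2
  k^2 there exhaust all nonnegative numbers.\<close>

definition sl_wave :: "real \<Rightarrow> real \<Rightarrow> real" where
  "sl_wave k x = sqrt 2 * k * sl (k * (x + 1))"

definition sl_wave' :: "real \<Rightarrow> real \<Rightarrow> real" where
  "sl_wave' k x = sqrt 2 * k\<^sup>2 * sl' (k * (x + 1))"

lemma DERIV_sl_wave: "(sl_wave k has_real_derivative sl_wave' k x) (at x)"
  unfolding sl_wave_def[abs_def] sl_wave'_def
  by (auto intro!: derivative_eq_intros DERIV_chain2[OF DERIV_sl] simp: power2_eq_square)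

lemma DERIV_sl_wave': "(sl_wave' k has_real_derivative - (sl_wave k x ^ 3)) (at x)"
proof -
  have "(sl_wave' k has_real_derivative sqrt 2 * k\<^sup>2 * (- 2 * sl (k * (x + 1)) ^ 3 * k)) (at x)"
    unfolding sl_wave'_def[abs_def]
    by (auto intro!: derivative_eq_intros DERIV_chain2[OF DERIV_sl'])
  moreover have "sqrt 2 * k\<^sup>2 * (- 2 * sl (k * (x + 1)) ^ 3 * k) = - (sl_wave k x ^ 3)"
    by (simp add: sl_wave_def power_mult_distrib power2_eq_square power3_eq_cube)
  ultimately show ?thesis by simp
qed

lemma continuous_sl_wave [continuous_intros]:
  "continuous_on S (sl_wave k)" "continuous_on S (sl_wave' k)"
  using DERIV_sl_wave DERIV_sl_wave'
  by (meson DERIV_isCont continuous_at_imp_continuous_on)+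

lemma sl_wave_A3:
  "sl_wave A3 (-1) = 0" "sl_wave A3 1 = 0" "sl_wave A3 0 = sqrt 2 * A3"
  "x \<in> II \<Longrightarrow> 0 < sl_wave A3 x" "\<bar>sl_wave A3 x\<bar> \<le> sqrt 2 * A3"
  using sl_2A3 A3_pos sl_A3 sl_pos[of "A3 * (x + 1)"] abs_sl_le_1[of "A3 * (x + 1)"]
  by (auto simp: sl_wave_def mult.commute abs_mult)

text \<open>The boundary terms of sl sl' vanish because \<open>sl\<close> is 0 at 0 and at 2 A3. So
  the profile has fourth power integral 2/3 and squared slope integral 4/3 over the interval of
  length 2; the factors 4 A3^4 and 2 A3^4 bring both to 8/3 A3^4.\<close>

lemma has_integral_sl_wave_A3:
  "((\<lambda>x. sl_wave A3 x ^ 4) has_integral 4 * A3 ^ 3 * B3) II_closed"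
  "((\<lambda>x. (sl_wave' A3 x)\<^sup>2) has_integral 4 * A3 ^ 3 * B3) II_closed"
proof -
  let ?s = "\<lambda>x. sl (A3 * (x + 1))" and ?c = "\<lambda>x. sl' (A3 * (x + 1))"
  have K: "4 * A3 ^ 3 * B3 = 8 / 3 * A3 ^ 4"
    using B3_eq by (simp add: power4_eq_xxxx power3_eq_cube)
  have "((\<lambda>x. A3 * (1 - 3 * ?s x ^ 4)) has_integral ?s 1 * ?c 1 - ?s (-1) * ?c (-1)) II_closed"
  proof (rule fundamental_theorem_of_calculus)
    fix x
    have "((\<lambda>x. ?s x * ?c x) has_real_derivative (?c x * A3) * ?c x + (- 2 * ?s x ^ 3 * A3) * ?s x) (at x)"
      by (intro DERIV_mult DERIV_chain2[OF DERIV_sl] DERIV_chain2[OF DERIV_sl'])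
        (auto intro!: derivative_eq_intros)
    moreover have "(?c x * A3) * ?c x + (- 2 * ?s x ^ 3 * A3) * ?s x = A3 * ((?c x)\<^sup>2 - 2 * ?s x ^ 4)"
      by (simp add: algebra_simps power2_eq_square power3_eq_cube power4_eq_xxxx)
    ultimately show "((\<lambda>x. ?s x * ?c x) has_vector_derivative A3 * (1 - 3 * ?s x ^ 4)) (at x within II_closed)"
      by (simp add: has_field_derivative_at_within sl'_squared
          flip: has_real_derivative_iff_has_vector_derivative)
  qed simp
  then have "((\<lambda>x. A3 * (1 - 3 * ?s x ^ 4)) has_integral 0) II_closed"
    using sl_2A3 by (simp add: mult.commute)
  from has_integral_mult_right[OF this, of "1 / (3 * A3)"]
  have "((\<lambda>x. (1 - 3 * ?s x ^ 4) / 3) has_integral 0) II_closed" using A3_pos by simp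
  from has_integral_diff[OF has_integral_const_real[of "1 / 3" "-1" 1] this]
  have s4: "((\<lambda>x. ?s x ^ 4) has_integral 2 / 3) II_closed"
    by (simp add: field_simps)
  have "sqrt 2 ^ 4 = (4::real)" using real_sqrt_pow2[of 2] by (simp add: power4_eq_xxxx)
  then have "(\<lambda>x. sl_wave A3 x ^ 4) = (\<lambda>x. 4 * A3 ^ 4 * ?s x ^ 4)"
    by (simp add: sl_wave_def power_mult_distrib)
  then show "((\<lambda>x. sl_wave A3 x ^ 4) has_integral 4 * A3 ^ 3 * B3) II_closed"
    using has_integral_mult_right[OF s4, of "4 * A3 ^ 4"] by (simp add: K)
  have "(\<lambda>x. (sl_wave' A3 x)\<^sup>2) = (\<lambda>x. 2 * A3 ^ 4 * (1 - ?s x ^ 4))"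
    by (simp add: sl_wave'_def power_mult_distrib sl'_squared flip: power_mult)
  moreover have "((\<lambda>x. 1 - ?s x ^ 4) has_integral 4 / 3) II_closed"
    using has_integral_diff[OF has_integral_const_real[of 1 "-1" 1] s4] by simp
  ultimately show "((\<lambda>x. (sl_wave' A3 x)\<^sup>2) has_integral 4 * A3 ^ 3 * B3) II_closed"
    using has_integral_mult_right[of "\<lambda>x. 1 - ?s x ^ 4" "4/3" II_closed "2 * A3 ^ 4"] by (simp add: K)
qed

text \<open>Applied at -1 to a positive solution, so that its initial slope can be written as sqrt 2
  k^2 with real k.\<close>

lemma one_sided_deriv_nonneg:
  fixes u :: "real \<Rightarrow> real"
  assumes "(u has_real_derivative D) (at a within {a..b})" "a < b"
    and "\<And>x. x \<in> {a<..<b} \<Longrightarrow> u a \<le> u x"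
  shows "0 \<le> D"
proof (rule ccontr)
  assume "\<not> 0 \<le> D"
  with has_real_derivative_neg_dec_right[OF assms(1)] obtain d where
    d: "0 < d" "\<And>h. 0 < h \<Longrightarrow> a + h \<in> {a..b} \<Longrightarrow> h < d \<Longrightarrow> u (a + h) < u a" by auto
  define h where "h = min (d / 2) ((b - a) / 2)"
  have "0 < h" "h < d" "a + h \<in> {a<..<b}" using d(1) assms(2) by (auto simp: h_def min_def field_simps)
  with d(2)[of h] assms(3)[of "a + h"] show False by auto
qed

lemma W3_problem_sl_wave:
  assumes W: "W3_problem W" and x: "x \<in> II_closed"
  shows "W x = sl_wave A3 x"
proof -
  obtain W' W'' where
    D: "\<And>x. x \<in> II_closed \<Longrightarrow> (W has_real_derivative W' x) (at x within II_closed)"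
      "\<And>x. x \<in> II_closed \<Longrightarrow> (W' has_real_derivative W'' x) (at x within II_closed)"
    and eq: "\<And>x. x \<in> II \<Longrightarrow> deriv (deriv W) x = W'' x" and cont: "continuous_on II_closed W"
    using W unfolding W3_problem_def by (elim conjE C2_closedE) blast
  have ode: "W'' x = - (W x ^ 3)" if "x \<in> II" for x
    using W eq[OF that] that unfolding W3_problem_def by (metis minus_minus)
  have pos: "\<And>x. x \<in> II \<Longrightarrow> 0 < W x" and bd: "W (-1) = 0" "W 1 = 0"
    using W by (auto simp: W3_problem_def)
  have "0 \<le> W' (-1)"
    by (rule one_sided_deriv_nonneg[of W _ "-1" 1]) (use D(1) pos bd in \<open>auto simp: less_imp_le\<close>)
  \<comment> \<open>This k gives \<open>sl_wave k\<close> the same slope at -1 as W.\<close>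
  define k where "k = sqrt (W' (-1) / sqrt 2)"
  have k: "0 \<le> k" "sqrt 2 * k\<^sup>2 = W' (-1)" using \<open>0 \<le> W' (-1)\<close> by (auto simp: k_def)
  \<comment> \<open>The cubic is Lipschitz only on bounded sets, so both functions are bounded
    first.\<close>
  have "compact (W ` II_closed)" using cont by (intro compact_continuous_image) auto
  then obtain M1 where M1: "\<And>x. x \<in> II_closed \<Longrightarrow> \<bar>W x\<bar> \<le> M1"
    by (fastforce dest!: compact_imp_bounded simp: bounded_iff)
  have "compact (sl_wave k ` II_closed)" by (intro compact_continuous_image continuous_intros) auto
  then obtain M2 where M2: "\<And>x. x \<in> II_closed \<Longrightarrow> \<bar>sl_wave k x\<bar> \<le> M2"
    by (fastforce dest!: compact_imp_bounded simp: bounded_iff)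
  have M: "0 \<le> M1" "0 \<le> M2" using M1[of 0] M2[of 0] by auto
  have eq: "W x = sl_wave k x" if "x \<in> II_closed" for x
  proof -
    have "W x - sl_wave k x = 0"
    proof (rule second_order_gronwall[where a = "-1" and b = 1 and d = "\<lambda>x. W x - sl_wave k x"
          and d' = "\<lambda>x. W' x - sl_wave' k x" and d'' = "\<lambda>x. W'' x - - (sl_wave k x ^ 3)"
          and L = "M1\<^sup>2 + M1 * M2 + M2\<^sup>2"])
      show "((\<lambda>x. W x - sl_wave k x) has_real_derivative W' x - sl_wave' k x) (at x within {-1..1})"
        if "x \<in> {-1..1}" for x
        using D(1)[OF that] has_field_derivative_at_within[OF DERIV_sl_wave] by (rule DERIV_diff)
      show "((\<lambda>x. W' x - sl_wave' k x) has_real_derivative W'' x - - (sl_wave k x ^ 3)) (at x within {-1..1})"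
        if "x \<in> {-1..1}" for x
        using D(2)[OF that] has_field_derivative_at_within[OF DERIV_sl_wave'] by (rule DERIV_diff)
      show "\<bar>W'' x - - (sl_wave k x ^ 3)\<bar> \<le> (M1\<^sup>2 + M1 * M2 + M2\<^sup>2) * \<bar>W x - sl_wave k x\<bar>"
        if x: "x \<in> {-1<..<1}" for x
      proof -
        let ?a = "W x" and ?b = "sl_wave k x"
        \<comment> \<open>Factorization of the difference of two cubes; the quadratic factor is
          bounded by the Lipschitz constant.\<close>
        have "W'' x - - (?b ^ 3) = - ((?a\<^sup>2 + ?a * ?b + ?b\<^sup>2) * (?a - ?b))"
          using ode[OF x] by (simp add: algebra_simps power2_eq_square power3_eq_cube)
        then have "\<bar>W'' x - - (?b ^ 3)\<bar> = \<bar>?a\<^sup>2 + ?a * ?b + ?b\<^sup>2\<bar> * \<bar>?a - ?b\<bar>"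
          by (simp only: abs_minus_cancel abs_mult)
        also have "\<dots> \<le> (M1\<^sup>2 + M1 * M2 + M2\<^sup>2) * \<bar>?a - ?b\<bar>"
        proof (rule mult_right_mono)
          have "\<bar>?a\<^sup>2 + ?a * ?b + ?b\<^sup>2\<bar> \<le> \<bar>?a\<bar>\<^sup>2 + \<bar>?a\<bar> * \<bar>?b\<bar> + \<bar>?b\<bar>\<^sup>2"
            using abs_triangle_ineq[of "?a\<^sup>2 + ?a * ?b" "?b\<^sup>2"] abs_triangle_ineq[of "?a\<^sup>2" "?a * ?b"]
            by (simp add: abs_mult)
          also have "\<dots> \<le> M1\<^sup>2 + M1 * M2 + M2\<^sup>2"
            using M1[of x] M2[of x] x M by (intro add_mono mult_mono power_mono) auto
          finally show "\<bar>?a\<^sup>2 + ?a * ?b + ?b\<^sup>2\<bar> \<le> M1\<^sup>2 + M1 * M2 + M2\<^sup>2" .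
        qed simp
        finally show ?thesis .
      qed
    qed (use that M k in \<open>auto simp: bd sl_wave_def sl_wave'_def\<close>)
    then show ?thesis by simp
  qed
  have "k \<noteq> 0" using eq[of 0] pos[of 0] by (auto simp: sl_wave_def)
  then have "0 < k" using k(1) by simp
  have "\<not> k < A3"
  proof
    \<comment> \<open>The first positive zero of the wave then lies beyond 1, against the boundary
      condition.\<close>
    assume "k < A3"
    then have "0 < sl (k * (1 + 1))" using \<open>0 < k\<close> by (intro sl_pos) auto
    then show False using eq[of 1] bd \<open>0 < k\<close> by (simp add: sl_wave_def)
  qed
  moreover have "\<not> A3 < k"
  proof
    assume "A3 < k"
    \<comment> \<open>The first zero of the wave after -1, which now falls inside the interval,
      against positivity.\<close>
    define y where "y = 2 * A3 / k - 1"
    have y: "y \<in> II" "k * (y + 1) = 2 * A3"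
      using \<open>A3 < k\<close> \<open>0 < k\<close> A3_pos by (auto simp: y_def field_simps)
    then show False using eq[of y] pos[of y] by (auto simp: sl_wave_def sl_2A3)
  qed
  ultimately show ?thesis using eq[OF x] by simp
qed

lemma W3_problem_iff: "W3_problem W \<longleftrightarrow> (\<forall>x\<in>II_closed. W x = sl_wave A3 x)"
proof
  assume W: "\<forall>x\<in>II_closed. W x = sl_wave A3 x"
  have "C2_closed W" "\<And>x. x \<in> II \<Longrightarrow> deriv (deriv W) x = - (sl_wave A3 x ^ 3)"
    by (rule C2_closedI[where u = "sl_wave A3" and u' = "sl_wave' A3" and u'' = "\<lambda>x. - (sl_wave A3 x ^ 3)"];
      use W in \<open>auto intro!: continuous_intros has_field_derivative_at_within DERIV_sl_wave DERIV_sl_wave'\<close>)+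
  with W show "W3_problem W" by (auto simp: W3_problem_def sl_wave_A3)
qed (use W3_problem_sl_wave in blast)

lemma W3_eq: "x \<in> II_closed \<Longrightarrow> W3 x = sl_wave A3 x"
proof -
  have "\<exists>!W. W3_problem W \<and> (\<forall>x. x \<notin> II_closed \<longrightarrow> W x = 0)"
  proof (rule ex1I[of _ "\<lambda>x. if x \<in> II_closed then sl_wave A3 x else 0"])
    fix W assume "W3_problem W \<and> (\<forall>x. x \<notin> II_closed \<longrightarrow> W x = 0)"
    then show "W = (\<lambda>x. if x \<in> II_closed then sl_wave A3 x else 0)"
      by (intro ext) (auto simp: W3_problem_iff)
  qed (auto simp: W3_problem_iff)
  from theI'[OF this] have "W3_problem W3" unfolding W3_def by blast
  then show "x \<in> II_closed \<Longrightarrow> W3 x = sl_wave A3 x" by (simp add: W3_problem_iff)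
qed

section \<open>The nonlocal problem as a rescaled local one\<close>

lemma L2norm_deriv_scaled:
  assumes v: "\<And>x. x \<in> II \<Longrightarrow> v x = c * f x"
    and f: "\<And>x. (f has_real_derivative f' x) (at x)" and "continuous_on II_closed f'"
    and K: "((\<lambda>x. (f' x)\<^sup>2) has_integral K) II_closed"
  shows "(L2norm (deriv v))\<^sup>2 = c\<^sup>2 * K"
proof -
  have "deriv v x = c * f' x" if "x \<in> II" for x
  proof -
    have "deriv v x = deriv (\<lambda>x. c * f x) x" by (rule deriv_cong_II[OF v that])
    also have "\<dots> = c * f' x" by (intro DERIV_imp_deriv DERIV_cmult f)
    finally show ?thesis .
  qed
  then have "(L2norm (deriv v))\<^sup>2 = integral II_closed (\<lambda>x. (c * f' x)\<^sup>2)"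
    by (intro L2norm_squared_eq continuous_intros assms)
  also have "\<dots> = c\<^sup>2 * K"
    using has_integral_mult_right[OF K, of "c\<^sup>2"] by (intro integral_unique) (simp add: power_mult_distrib)
  finally show ?thesis .
qed

lemma C2_closed_scaled:
  assumes v: "\<And>x. x \<in> II_closed \<Longrightarrow> v x = c * f x"
    and f: "\<And>x. (f has_real_derivative f' x) (at x)" "\<And>x. (f' has_real_derivative f'' x) (at x)"
    and cont: "continuous_on II_closed f''"
  shows "C2_closed v" and "\<And>x. x \<in> II \<Longrightarrow> deriv (deriv v) x = c * f'' x"
proof -
  have D: "((\<lambda>x. c * f x) has_real_derivative c * f' x) (at x within II_closed)"
    "((\<lambda>x. c * f' x) has_real_derivative c * f'' x) (at x within II_closed)" for x
    by (rule has_field_derivative_at_within, rule DERIV_cmult, rule f)+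
  have "continuous_on II_closed (\<lambda>x. c * f'' x)" by (intro continuous_intros cont)
  with v D show "C2_closed v" "\<And>x. x \<in> II \<Longrightarrow> deriv (deriv v) x = c * f'' x"
    using C2_closedI[of v "\<lambda>x. c * f x" "\<lambda>x. c * f' x" "\<lambda>x. c * f'' x"] by blast+
qed

lemma deriv_W3_norm: "(L2norm (deriv W3))\<^sup>2 = 4 * A3 ^ 3 * B3"
  using L2norm_deriv_scaled[of W3 1 "sl_wave A3" "sl_wave' A3"] W3_eq
  by (simp add: DERIV_sl_wave continuous_sl_wave has_integral_sl_wave_A3)

text \<open>For a solution v with coefficient N, the multiple \<open>\<kappa> * v\<close> with
  \<open>\<kappa>\<^sup>2 = lam / N\<close> solves the local problem, hence is the wave. Inserting
  its norm into N gives lam - a K = b \<kappa>^2. The bound on \<open>lam\<close> makes the left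
  side positive, so exactly one positive multiple remains.\<close>

lemma kirchhoff_cubic_iff:
  assumes ab: "0 < a" "0 < b" and lam: "4 * a * A3 ^ 3 * B3 < lam"
  shows "kirchhoff_solution a b 3 lam v \<longleftrightarrow>
    (\<forall>x\<in>II_closed. v x = sqrt (b / (lam - 4 * a * A3 ^ 3 * B3)) * sl_wave A3 x)"
proof -
  define K where "K = 4 * A3 ^ 3 * B3"
  have K: "0 < K" using A3_pos B3_eq by (simp add: K_def)
  define c where "c = sqrt (b / (lam - a * K))"
  have lamK: "0 < lam - a * K" using lam by (simp add: K_def)
  then have c: "0 < c" "c\<^sup>2 = b / (lam - a * K)" using ab by (auto simp: c_def)
  have "0 < lam" using lamK mult_pos_pos[OF ab(1) K] by linarith
  have norm: "(L2norm (deriv v))\<^sup>2 = t\<^sup>2 * K" if "\<And>x. x \<in> II_closed \<Longrightarrow> v x = t * sl_wave A3 x" for t v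
    by (rule L2norm_deriv_scaled[where f = "sl_wave A3" and f' = "sl_wave' A3"])
      (use that has_integral_sl_wave_A3(2) in \<open>auto intro: continuous_intros DERIV_sl_wave simp: K_def\<close>)
  have "kirchhoff_solution a b 3 lam v \<longleftrightarrow> (\<forall>x\<in>II_closed. v x = c * sl_wave A3 x)"
  proof
    assume v: "kirchhoff_solution a b 3 lam v"
    define N where "N = b + a * (L2norm (deriv v))\<^sup>2"
    define \<kappa> where "\<kappa> = sqrt (lam / N)"
    have "0 < N" using ab by (simp add: N_def add_pos_nonneg)
    then have \<kappa>: "0 < \<kappa>" "\<kappa>\<^sup>2 = lam / N" using \<open>0 < lam\<close> by (auto simp: \<kappa>_def)
    have pos: "\<And>x. x \<in> II \<Longrightarrow> 0 < v x" using v by (simp add: kirchhoff_solution_def)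
    obtain v' v'' where
      D: "\<And>x. x \<in> II_closed \<Longrightarrow> (v has_real_derivative v' x) (at x within II_closed)"
        "\<And>x. x \<in> II_closed \<Longrightarrow> (v' has_real_derivative v'' x) (at x within II_closed)"
      and eq: "\<And>x. x \<in> II \<Longrightarrow> deriv (deriv v) x = v'' x" and cont: "continuous_on II_closed v''"
      using v unfolding kirchhoff_solution_def by (elim conjE C2_closedE) blast
    have ode: "- N * v'' x = lam * v x ^ 3" if "x \<in> II" for x
      using v eq[OF that] that pos[OF that] unfolding kirchhoff_solution_def N_def by fastforce
    let ?w = "\<lambda>x. \<kappa> * v x"
    have w: "C2_closed ?w" "\<And>x. x \<in> II \<Longrightarrow> deriv (deriv ?w) x = \<kappa> * v'' x"
      by (rule C2_closedI[where u = ?w and u' = "\<lambda>x. \<kappa> * v' x" and u'' = "\<lambda>x. \<kappa> * v'' x"];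
        use D cont in \<open>auto intro!: continuous_intros DERIV_cmult\<close>)+
    have "- (\<kappa> * v'' x) = (\<kappa> * v x) ^ 3" if "x \<in> II" for x
    proof -
      have "- v'' x = \<kappa>\<^sup>2 * v x ^ 3" using ode[OF that] \<open>0 < N\<close> by (simp add: \<kappa>(2) field_simps)
      then have "\<kappa> * - v'' x = \<kappa> * (\<kappa>\<^sup>2 * v x ^ 3)" by simp
      then show ?thesis by (simp add: power_mult_distrib power2_eq_square power3_eq_cube)
    qed
    then have "W3_problem ?w"
      using w v \<kappa>(1) by (simp add: W3_problem_def kirchhoff_solution_def)
    then have v_eq: "v x = (1 / \<kappa>) * sl_wave A3 x" if "x \<in> II_closed" for x
      using that \<kappa>(1) by (auto simp: W3_problem_iff field_simps)
    have "N = b + a * (K / \<kappa>\<^sup>2)" using norm[OF v_eq] by (simp add: N_def power_divide)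
    then have "N * \<kappa>\<^sup>2 = b * \<kappa>\<^sup>2 + a * K" using \<kappa>(1) by (simp add: field_simps)
    then have "lam - a * K = b * \<kappa>\<^sup>2" using \<kappa>(2) \<open>0 < N\<close> by simp
    then have "c\<^sup>2 = (1 / \<kappa>)\<^sup>2" using ab \<kappa>(1) by (simp add: c(2) power_divide)
    then have "c = 1 / \<kappa>" using c(1) \<kappa>(1) by (simp add: power2_eq_iff_nonneg)
    with v_eq show "\<forall>x\<in>II_closed. v x = c * sl_wave A3 x" by simp
  next
    assume v: "\<forall>x\<in>II_closed. v x = c * sl_wave A3 x"
    have C: "C2_closed v" "\<And>x. x \<in> II \<Longrightarrow> deriv (deriv v) x = c * - (sl_wave A3 x ^ 3)"
      by (rule C2_closed_scaled[OF _ DERIV_sl_wave DERIV_sl_wave'];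
        use v in \<open>auto intro!: continuous_intros\<close>)+
    have "b + a * (L2norm (deriv v))\<^sup>2 = lam * c\<^sup>2"
      using norm[of v c] v lamK by (simp add: c(2) field_simps)
    \<comment> \<open>The real power agrees with the natural one because the base is positive in the
      open interval.\<close>
    moreover have "v x powr 3 = (c * sl_wave A3 x) ^ 3" if "x \<in> II" for x
      using that v c(1) sl_wave_A3(4)[OF that] by (auto simp: zero_less_mult_iff)
    ultimately have "- (b + a * (L2norm (deriv v))\<^sup>2) * deriv (deriv v) x = lam * v x powr 3"
      if "x \<in> II" for x
      using C(2)[OF that] that by (simp add: power_mult_distrib power2_eq_square power3_eq_cube)
    moreover have "0 < v x" if "x \<in> II" for x
      using that v c(1) sl_wave_A3(4)[OF that] by simp
    moreover have "v (-1) = 0" "v 1 = 0" using v sl_wave_A3(1,2) by simp_all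
    ultimately show "kirchhoff_solution a b 3 lam v"
      using C(1) unfolding kirchhoff_solution_def by blast
  qed
  then show ?thesis by (simp add: c_def K_def mult_ac)
qed

section \<open>The linear case\<close>

lemma DERIV_cos_half_pi:
  "((\<lambda>x. cos (pi / 2 * x)) has_real_derivative - (pi / 2) * sin (pi / 2 * x)) (at x)"
  "((\<lambda>x. - (pi / 2) * sin (pi / 2 * x)) has_real_derivative - (pi\<^sup>2 / 4) * cos (pi / 2 * x)) (at x)"
  by (auto intro!: derivative_eq_intros simp: power2_eq_square)

lemma has_integral_sin_half_pi:
  "((\<lambda>x. (- (pi / 2) * sin (pi / 2 * x))\<^sup>2) has_integral pi\<^sup>2 / 4) II_closed"
proof -
  let ?F = "\<lambda>x. pi\<^sup>2 / 4 * (x / 2 - sin (pi * x) / (2 * pi))"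
  have "((\<lambda>x. (- (pi / 2) * sin (pi / 2 * x))\<^sup>2) has_integral ?F 1 - ?F (-1)) II_closed"
  proof (rule fundamental_theorem_of_calculus)
    fix x :: real
    have "(?F has_real_derivative pi\<^sup>2 / 4 * (1 / 2 - cos (pi * x) / 2)) (at x)"
      by (auto intro!: derivative_eq_intros)
    moreover have "cos (pi * x) = 1 - 2 * (sin (pi / 2 * x))\<^sup>2"
      using cos_double_sin[of "pi / 2 * x"] by simp
    then have "pi\<^sup>2 / 4 * (1 / 2 - cos (pi * x) / 2) = (- (pi / 2) * sin (pi / 2 * x))\<^sup>2"
      by (simp add: power_mult_distrib power_divide) (simp add: field_simps)
    ultimately show "(?F has_vector_derivative (- (pi / 2) * sin (pi / 2 * x))\<^sup>2) (at x within II_closed)"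
      by (simp add: has_field_derivative_at_within flip: has_real_derivative_iff_has_vector_derivative)
  qed simp
  then show ?thesis by simp
qed

lemma cos_half_pi_pos: "x \<in> II \<Longrightarrow> 0 < cos (pi / 2 * x)"
  using mult_strict_left_mono[of "-1" x "pi / 2"] mult_strict_left_mono[of x 1 "pi / 2"]
  by (intro cos_gt_zero_pi) auto

text \<open>By uniqueness for the initial value problem at -1, v is a multiple of sin (\<omega> (x +
  1)). A smaller frequency leaves it nonzero at 1, a larger one makes it vanish inside. The equation
  is homogeneous, so the amplitude \<open>v 0\<close> stays free; only the nonlocal coefficient will
  fix it.\<close>

lemma linear_eigenfunction:
  assumes D: "\<And>x. x \<in> II_closed \<Longrightarrow> (v has_real_derivative v' x) (at x within II_closed)"
      "\<And>x. x \<in> II_closed \<Longrightarrow> (v' has_real_derivative v'' x) (at x within II_closed)"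
    and ode: "\<And>x. x \<in> II \<Longrightarrow> v'' x = - (\<omega>\<^sup>2 * v x)" and "0 < \<omega>"
    and pos: "\<And>x. x \<in> II \<Longrightarrow> 0 < v x" and bd: "v (-1) = 0" "v 1 = 0"
  shows "\<omega> = pi / 2" "\<And>x. x \<in> II_closed \<Longrightarrow> v x = v 0 * cos (pi / 2 * x)"
proof -
  define C where "C = v' (-1) / \<omega>"
  have eq: "v x = C * sin (\<omega> * (x + 1))" if "x \<in> II_closed" for x
  proof -
    have "v x - C * sin (\<omega> * (x + 1)) = 0"
    proof (rule second_order_gronwall[where a = "-1" and b = 1 and d = "\<lambda>x. v x - C * sin (\<omega> * (x + 1))"
          and d' = "\<lambda>x. v' x - C * (\<omega> * cos (\<omega> * (x + 1)))"
          and d'' = "\<lambda>x. v'' x - C * (- (\<omega>\<^sup>2) * sin (\<omega> * (x + 1)))" and L = "\<omega>\<^sup>2"])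
      show "((\<lambda>x. v x - C * sin (\<omega> * (x + 1))) has_real_derivative
          v' x - C * (\<omega> * cos (\<omega> * (x + 1)))) (at x within {-1..1})" if "x \<in> {-1..1}" for x
        using D(1)[OF that] by (rule DERIV_diff) (auto intro!: derivative_eq_intros)
      show "((\<lambda>x. v' x - C * (\<omega> * cos (\<omega> * (x + 1)))) has_real_derivative
          v'' x - C * (- (\<omega>\<^sup>2) * sin (\<omega> * (x + 1)))) (at x within {-1..1})" if "x \<in> {-1..1}" for x
        using D(2)[OF that]
        by (rule DERIV_diff) (auto intro!: derivative_eq_intros simp: power2_eq_square)
      show "\<bar>v'' x - C * (- (\<omega>\<^sup>2) * sin (\<omega> * (x + 1)))\<bar> \<le> \<omega>\<^sup>2 * \<bar>v x - C * sin (\<omega> * (x + 1))\<bar>"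
        if "x \<in> {-1<..<1}" for x
      proof -
        have "v'' x - C * (- (\<omega>\<^sup>2) * sin (\<omega> * (x + 1))) = - (\<omega>\<^sup>2 * (v x - C * sin (\<omega> * (x + 1))))"
          using ode[OF that] by (simp add: algebra_simps)
        then show ?thesis by (simp add: abs_mult)
      qed
    qed (use that \<open>0 < \<omega>\<close> in \<open>auto simp: bd C_def\<close>)
    then show ?thesis by simp
  qed
  have "C \<noteq> 0" using eq[of 0] pos[of 0] by auto
  have "\<not> \<omega> < pi / 2"
  proof
    assume "\<omega> < pi / 2"
    then have "0 < sin (\<omega> * (1 + 1))" using \<open>0 < \<omega>\<close> by (intro sin_gt_zero) auto
    then show False using eq[of 1] bd \<open>C \<noteq> 0\<close> by simp
  qed
  moreover have "\<not> pi / 2 < \<omega>"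
  proof
    assume "pi / 2 < \<omega>"
    \<comment> \<open>The first zero of the sine after -1.\<close>
    define y where "y = pi / \<omega> - 1"
    have y: "y \<in> II" "\<omega> * (y + 1) = pi"
      using \<open>pi / 2 < \<omega>\<close> \<open>0 < \<omega>\<close> by (auto simp: y_def field_simps)
    then show False using eq[of y] pos[of y] by auto
  qed
  ultimately show \<omega>: "\<omega> = pi / 2" by simp
  have "sin (\<omega> * (x + 1)) = cos (pi / 2 * x)" for x
    unfolding \<omega> using sin_add[of "pi / 2 * x" "pi / 2"] by (simp add: distrib_left)
  with eq show "v x = v 0 * cos (pi / 2 * x)" if "x \<in> II_closed" for x
    using that by simp
qed

text \<open>The frequency pi / 2 forces the coefficient b + a |v'|^2 to be 4 lam / pi^2. Since
  |v'|^2 is pi^2 / 4 times the squared amplitude, this determines the amplitude, and the bound on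
  \<open>lam\<close> makes its square positive.\<close>

lemma kirchhoff_linear_iff:
  assumes ab: "0 < a" "0 < b" and lam: "pi\<^sup>2 / 4 * b < lam"
  shows "kirchhoff_solution a b 1 lam v \<longleftrightarrow>
    (\<forall>x\<in>II_closed. v x = 4 / pi\<^sup>2 * sqrt ((lam - pi\<^sup>2 * b / 4) / a) * cos (pi / 2 * x))"
proof -
  define c where "c = 4 / pi\<^sup>2 * sqrt ((lam - pi\<^sup>2 * b / 4) / a)"
  have c: "0 < c" "c\<^sup>2 = 16 / pi ^ 4 * ((lam - pi\<^sup>2 * b / 4) / a)"
  proof -
    have p: "0 < (lam - pi\<^sup>2 * b / 4) / a" using lam ab by simp
    then show "0 < c" by (simp add: c_def)
    show "c\<^sup>2 = 16 / pi ^ 4 * ((lam - pi\<^sup>2 * b / 4) / a)"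
      unfolding c_def power_mult_distrib power_divide real_sqrt_pow2[OF less_imp_le[OF p]]
      by simp
  qed
  \<comment> \<open>The equation that determines the amplitude; both directions of the equivalence
    rest on it.\<close>
  have c': "a * (c\<^sup>2 * (pi\<^sup>2 / 4)) = 4 * lam / pi\<^sup>2 - b"
  proof -
    have "a * (c\<^sup>2 * (pi\<^sup>2 / 4)) = 4 / pi\<^sup>2 * (lam - pi\<^sup>2 * b / 4)"
      unfolding c(2) using ab(1) by (simp add: field_simps power4_eq_xxxx power2_eq_square)
    also have "\<dots> = 4 * lam / pi\<^sup>2 - b" by (simp add: right_diff_distrib)
    finally show ?thesis .
  qed
  have "0 < pi\<^sup>2 / 4 * b" using ab by simp
  with lam have "0 < lam" by linarith
  have norm: "(L2norm (deriv v))\<^sup>2 = t\<^sup>2 * (pi\<^sup>2 / 4)"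
    if "\<And>x. x \<in> II_closed \<Longrightarrow> v x = t * cos (pi / 2 * x)" for t v
    by (rule L2norm_deriv_scaled[OF _ DERIV_cos_half_pi(1) _ has_integral_sin_half_pi])
      (use that in \<open>auto intro!: continuous_intros\<close>)
  have "kirchhoff_solution a b 1 lam v \<longleftrightarrow> (\<forall>x\<in>II_closed. v x = c * cos (pi / 2 * x))"
  proof
    assume v: "kirchhoff_solution a b 1 lam v"
    define N where "N = b + a * (L2norm (deriv v))\<^sup>2"
    have "0 < N" using ab by (simp add: N_def add_pos_nonneg)
    have pos: "\<And>x. x \<in> II \<Longrightarrow> 0 < v x" using v by (simp add: kirchhoff_solution_def)
    obtain v' v'' where
      D: "\<And>x. x \<in> II_closed \<Longrightarrow> (v has_real_derivative v' x) (at x within II_closed)"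
        "\<And>x. x \<in> II_closed \<Longrightarrow> (v' has_real_derivative v'' x) (at x within II_closed)"
      and eq: "\<And>x. x \<in> II \<Longrightarrow> deriv (deriv v) x = v'' x"
      using v unfolding kirchhoff_solution_def by (elim conjE C2_closedE) blast
    have ode: "- N * v'' x = lam * v x" if "x \<in> II" for x
      using v eq[OF that] that pos[OF that] unfolding kirchhoff_solution_def N_def by fastforce
    define \<omega> where "\<omega> = sqrt (lam / N)"
    have \<omega>: "0 < \<omega>" "\<omega>\<^sup>2 = lam / N" using \<open>0 < lam\<close> \<open>0 < N\<close> by (auto simp: \<omega>_def)
    have ode': "v'' x = - (\<omega>\<^sup>2 * v x)" if "x \<in> II" for x
      using ode[OF that] \<open>0 < N\<close> by (simp add: \<omega>(2) field_simps)
    have bd: "v (-1) = 0" "v 1 = 0" using v by (auto simp: kirchhoff_solution_def)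
    have eig: "\<omega> = pi / 2" "\<And>x. x \<in> II_closed \<Longrightarrow> v x = v 0 * cos (pi / 2 * x)"
      by (rule linear_eigenfunction[where v = v and v' = v' and v'' = v'' and \<omega> = \<omega>];
        use D ode' \<omega>(1) pos bd in blast)+
    have "lam / N = (pi / 2)\<^sup>2" using \<omega>(2) by (simp only: eig(1))
    then have "lam / N = pi\<^sup>2 / 4" by (simp add: power_divide)
    then have "N = 4 * lam / pi\<^sup>2" using \<open>0 < N\<close> by (simp add: field_simps)
    moreover have "N = b + a * ((v 0)\<^sup>2 * (pi\<^sup>2 / 4))" using norm[OF eig(2)] by (simp add: N_def)
    ultimately have "a * ((v 0)\<^sup>2 * (pi\<^sup>2 / 4)) = a * (c\<^sup>2 * (pi\<^sup>2 / 4))" unfolding c' by simp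
    then have "(v 0)\<^sup>2 = c\<^sup>2" using ab by simp
    then have "v 0 = c" using pos[of 0] c(1) by (simp add: power2_eq_iff_nonneg)
    then show "\<forall>x\<in>II_closed. v x = c * cos (pi / 2 * x)" using eig(2) by metis
  next
    assume v: "\<forall>x\<in>II_closed. v x = c * cos (pi / 2 * x)"
    have C: "C2_closed v" "\<And>x. x \<in> II \<Longrightarrow> deriv (deriv v) x = c * (- (pi\<^sup>2 / 4) * cos (pi / 2 * x))"
      by (rule C2_closed_scaled[OF _ DERIV_cos_half_pi];
        use v in \<open>auto intro!: continuous_intros\<close>)+
    have "(L2norm (deriv v))\<^sup>2 = c\<^sup>2 * (pi\<^sup>2 / 4)" using v by (intro norm) blast
    then have "a * (L2norm (deriv v))\<^sup>2 = 4 * lam / pi\<^sup>2 - b" by (simp only: c')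
    then have N: "b + a * (L2norm (deriv v))\<^sup>2 = 4 * lam / pi\<^sup>2" by simp
    have pos: "0 < v x" if "x \<in> II" for x
      using that v c(1) cos_half_pi_pos[OF that] by simp
    have "- (b + a * (L2norm (deriv v))\<^sup>2) * deriv (deriv v) x = lam * v x powr 1"
      if "x \<in> II" for x
    proof -
      have "- (b + a * (L2norm (deriv v))\<^sup>2) * deriv (deriv v) x
          = - (4 * lam / pi\<^sup>2) * (c * (- (pi\<^sup>2 / 4) * cos (pi / 2 * x)))"
        by (simp only: N C(2)[OF that])
      also have "\<dots> = lam * (c * cos (pi / 2 * x))" by simp
      also have "c * cos (pi / 2 * x) = v x powr 1" using v that pos[OF that] by simp
      finally show ?thesis .
    qed
    moreover have "v (-1) = 0" "v 1 = 0" using v by simp_all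
    ultimately show "kirchhoff_solution a b 1 lam v"
      using C(1) pos unfolding kirchhoff_solution_def by blast
  qed
  then show ?thesis by (simp add: c_def)
qed

section \<open>The sharp inequality\<close>

text \<open>The absolute value only serves to make the antiderivative defined on the whole line; on the
  range of a normalized function it disappears.\<close>

definition calib :: "real \<Rightarrow> real" where
  "calib = (SOME F. F 0 = 0 \<and> (\<forall>s. (F has_real_derivative sqrt \<bar>1 - s ^ 4\<bar>) (at s)))"

lemma calib: "calib 0 = 0" "(calib has_real_derivative sqrt \<bar>1 - s ^ 4\<bar>) (at s)"
proof -
  have "\<exists>F. \<forall>x. -\<infinity> < ereal x \<longrightarrow> ereal x < \<infinity> \<longrightarrow>
      (F has_vector_derivative sqrt \<bar>1 - x ^ 4\<bar>) (at x)"
    by (intro einterval_antiderivative continuous_intros) auto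
  then obtain F where "\<And>x. (F has_real_derivative sqrt \<bar>1 - x ^ 4\<bar>) (at x)"
    by (auto simp: has_real_derivative_iff_has_vector_derivative)
  then have "(\<lambda>x. F x - F 0) 0 = 0 \<and>
      (\<forall>s. ((\<lambda>x. F x - F 0) has_real_derivative sqrt \<bar>1 - s ^ 4\<bar>) (at s))"
    by (auto intro!: derivative_eq_intros)
  then have "calib 0 = 0 \<and> (\<forall>s. (calib has_real_derivative sqrt \<bar>1 - s ^ 4\<bar>) (at s))"
    unfolding calib_def
    by (rule someI[where P = "\<lambda>F. F 0 = 0 \<and>
      (\<forall>s. (F has_real_derivative sqrt \<bar>1 - s ^ 4\<bar>) (at s))"])
  then show "calib 0 = 0" "(calib has_real_derivative sqrt \<bar>1 - s ^ 4\<bar>) (at s)" by auto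
qed

lemma calib_1: "calib 1 = B3"
proof -
  have "((\<lambda>s. sqrt \<bar>1 - s ^ 4\<bar>) has_integral calib 1 - calib 0) {0..1}"
    by (rule fundamental_theorem_of_calculus)
      (auto intro: has_field_derivative_at_within[OF calib(2)]
        simp flip: has_real_derivative_iff_has_vector_derivative)
  moreover have "((\<lambda>s. sqrt \<bar>1 - s ^ 4\<bar>) has_integral calib 1 - calib 0) {0..1} \<longleftrightarrow>
      ((\<lambda>s. sqrt (1 - s ^ 4)) has_integral calib 1 - calib 0) {0..1::real}"
    by (rule has_integral_cong) (simp add: power_le_one)
  ultimately show ?thesis by (simp add: B3_def calib(1) integral_unique)
qed

text \<open>Along f the calibration rises by B3 before c and falls by B3 after it, so the integral
  of f'^2 + A3^2 (1 - f^4) is at least 4 A3 B3 = 8/3 A3^2. The constant part of that integrand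
  contributes 2 A3^2, which leaves the 2/3.\<close>

lemma sharp_ineq_normalized:
  fixes f f' :: "real \<Rightarrow> real"
  assumes f: "\<And>x. (f has_real_derivative f' x) (at x)" and cont: "continuous_on II_closed f'"
    and bd: "f (-1) = 0" "f 1 = 0" and c: "c \<in> II_closed" "f c = 1"
    and le: "\<And>x. x \<in> II_closed \<Longrightarrow> \<bar>f x\<bar> \<le> 1"
  shows "A3\<^sup>2 * (integral II_closed (\<lambda>x. f x ^ 4) + 2 / 3) \<le> integral II_closed (\<lambda>x. (f' x)\<^sup>2)"
proof -
  have contf: "continuous_on S f" for S
    using f by (meson DERIV_isCont continuous_at_imp_continuous_on)
  let ?g = "\<lambda>x. sqrt \<bar>1 - f x ^ 4\<bar> * f' x"
  have D: "((\<lambda>x. calib (f x)) has_real_derivative ?g x) (at x)" for x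
    by (rule DERIV_chain2[OF calib(2) f])
  have I: "(?g has_integral calib (f q) - calib (f p)) {p..q}" if "p \<le> q" for p q
    by (rule fundamental_theorem_of_calculus[OF that])
      (auto intro: has_field_derivative_at_within[OF D]
        simp flip: has_real_derivative_iff_has_vector_derivative)
  define q where "q x = (f' x)\<^sup>2 + A3\<^sup>2 * (1 - f x ^ 4)" for x
  have contq: "continuous_on {p..r} q" if "{p..r} \<subseteq> II_closed" for p r
    unfolding q_def[abs_def] by (intro continuous_intros continuous_on_subset[OF cont that] contf)
  \<comment> \<open>2 y z <= y^2 + z^2 with y = |f'| and z = A3 sqrt (1 - f^4); the bound on f makes
    the absolute value under the root disappear.\<close>
  have pt: "2 * A3 * \<bar>?g x\<bar> \<le> q x" if "x \<in> II_closed" for x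
  proof -
    have "f x ^ 4 \<le> 1"
      using power_mono[OF le[OF that], of 4] by simp
    then have "q x = \<bar>f' x\<bar>\<^sup>2 + (A3 * sqrt \<bar>1 - f x ^ 4\<bar>)\<^sup>2"
      by (simp add: q_def power_mult_distrib)
    moreover have "2 * \<bar>f' x\<bar> * (A3 * sqrt \<bar>1 - f x ^ 4\<bar>) \<le> \<dots>" by (rule sum_squares_bound)
    ultimately show ?thesis by (simp add: abs_mult mult_ac)
  qed
  have "2 * A3 * B3 \<le> integral {-1..c} q"
  proof (rule has_integral_le)
    show "((\<lambda>x. 2 * A3 * ?g x) has_integral 2 * A3 * B3) {-1..c}"
      using has_integral_mult_right[OF I[of "-1" c], of "2 * A3"] c bd by (simp add: calib calib_1)
    show "(q has_integral integral {-1..c} q) {-1..c}"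
      using c by (intro integrable_integral integrable_continuous_real contq) auto
    show "2 * A3 * ?g x \<le> q x" if "x \<in> {-1..c}" for x
    proof -
      have "2 * A3 * ?g x \<le> 2 * A3 * \<bar>?g x\<bar>" using A3_pos by (intro mult_left_mono) auto
      moreover have "2 * A3 * \<bar>?g x\<bar> \<le> q x" using that c by (intro pt) auto
      ultimately show ?thesis by linarith
    qed
  qed
  moreover have "2 * A3 * B3 \<le> integral {c..1} q"
  proof (rule has_integral_le)
    \<comment> \<open>The sign is reversed because f runs from 1 back to 0 on this side.\<close>
    show "((\<lambda>x. - (2 * A3) * ?g x) has_integral 2 * A3 * B3) {c..1}"
      using has_integral_mult_right[OF I[of c 1], of "- (2 * A3)"] c bd by (simp add: calib calib_1)
    show "(q has_integral integral {c..1} q) {c..1}"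
      using c by (intro integrable_integral integrable_continuous_real contq) auto
    show "- (2 * A3) * ?g x \<le> q x" if "x \<in> {c..1}" for x
    proof -
      have "2 * A3 * - ?g x \<le> 2 * A3 * \<bar>?g x\<bar>" using A3_pos by (intro mult_left_mono) auto
      moreover have "2 * A3 * \<bar>?g x\<bar> \<le> q x" using that c by (intro pt) auto
      ultimately show ?thesis by linarith
    qed
  qed
  moreover have "integral {-1..c} q + integral {c..1} q = integral II_closed q"
    using c by (intro Henstock_Kurzweil_Integration.integral_combine integrable_continuous_real contq) auto
  moreover have "integral II_closed q = integral II_closed (\<lambda>x. (f' x)\<^sup>2) + A3\<^sup>2 * (2 - integral II_closed (\<lambda>x. f x ^ 4))"
  proof (rule integral_unique)
    have "(\<lambda>x. f x ^ 4) integrable_on II_closed"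
      by (intro integrable_continuous_real continuous_intros contf)
    from has_integral_diff[OF has_integral_const_real[of 1 "-1" 1] integrable_integral[OF this]]
    have "((\<lambda>x. 1 - f x ^ 4) has_integral 2 - integral II_closed (\<lambda>x. f x ^ 4)) II_closed" by simp
    moreover have "(\<lambda>x. (f' x)\<^sup>2) integrable_on II_closed"
      by (intro integrable_continuous_real continuous_intros cont)
    ultimately show "(q has_integral integral II_closed (\<lambda>x. (f' x)\<^sup>2) + A3\<^sup>2 * (2 - integral II_closed (\<lambda>x. f x ^ 4))) II_closed"
      unfolding q_def[abs_def]
      by (intro has_integral_add has_integral_mult_right integrable_integral)
  qed
  ultimately have "4 * A3 * B3 \<le> integral II_closed (\<lambda>x. (f' x)\<^sup>2) + A3\<^sup>2 * (2 - integral II_closed (\<lambda>x. f x ^ 4))"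
    by simp
  moreover have "4 * A3 * B3 = 8 / 3 * A3\<^sup>2" using B3_eq by (simp add: power2_eq_square)
  ultimately show ?thesis by (simp add: algebra_simps)
qed

text \<open>Both conclusions come from the inequality \<open>key\<close>: the first by the
  arithmetic-geometric mean inequality, the second by dropping Q. The second is a Sobolev bound for
  the maximum norm, used later as the dominating constant.\<close>

lemma sharp_ineq:
  fixes f f' :: "real \<Rightarrow> real"
  assumes f: "\<And>x. (f has_real_derivative f' x) (at x)" and cont: "continuous_on II_closed f'"
    and bd: "f (-1) = 0" "f 1 = 0"
  defines "P \<equiv> integral II_closed (\<lambda>x. (f' x)\<^sup>2)" and "Q \<equiv> integral II_closed (\<lambda>x. f x ^ 4)"
  shows "4 * A3 ^ 3 * B3 * Q \<le> P\<^sup>2" and "x \<in> II_closed \<Longrightarrow> 2 / 3 * A3\<^sup>2 * (f x)\<^sup>2 \<le> P"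
proof -
  have contf: "continuous_on S f" for S
    using f by (meson DERIV_isCont continuous_at_imp_continuous_on)
  have "\<exists>x0\<in>II_closed. \<forall>x\<in>II_closed. \<bar>f x\<bar> \<le> \<bar>f x0\<bar>"
    by (intro continuous_attains_sup continuous_intros contf) auto
  then obtain x0 where x0: "x0 \<in> II_closed" "\<And>x. x \<in> II_closed \<Longrightarrow> \<bar>f x\<bar> \<le> \<bar>f x0\<bar>" by blast
  have P0: "0 \<le> P" unfolding P_def
    by (intro integral_nonneg integrable_continuous_real continuous_intros cont) auto
  have Q0: "0 \<le> Q" unfolding Q_def
    by (intro integral_nonneg integrable_continuous_real continuous_intros contf) auto
  show "4 * A3 ^ 3 * B3 * Q \<le> P\<^sup>2" and "x \<in> II_closed \<Longrightarrow> 2 / 3 * A3\<^sup>2 * (f x)\<^sup>2 \<le> P"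
  proof (atomize (full), cases "f x0 = 0")
    case True
    then have z: "f x = 0" if "x \<in> II_closed" for x using x0(2)[OF that] by simp
    then have "Q = integral II_closed (\<lambda>x. 0)" unfolding Q_def by (intro Henstock_Kurzweil_Integration.integral_cong) auto
    then show "4 * A3 ^ 3 * B3 * Q \<le> P\<^sup>2 \<and> (x \<in> II_closed \<longrightarrow> 2 / 3 * A3\<^sup>2 * (f x)\<^sup>2 \<le> P)"
      using z P0 by simp
  next
    case False
    define m where "m = (f x0)\<^sup>2"
    have m: "0 < m" using False by (simp add: m_def)
    \<comment> \<open>Division by \<open>f x0\<close> itself, not by its modulus, makes the value at
      the maximum point exactly 1 whatever its sign.\<close>
    have "A3\<^sup>2 * (integral II_closed (\<lambda>x. (f x / f x0) ^ 4) + 2 / 3) \<le> integral II_closed (\<lambda>x. (f' x / f x0)\<^sup>2)"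
      by (rule sharp_ineq_normalized[where c = x0])
        (use False x0 in \<open>auto intro!: DERIV_cdivide f continuous_intros cont simp: bd\<close>)
    moreover have "integral II_closed (\<lambda>x. (f x / f x0) ^ 4) = Q / m\<^sup>2"
      unfolding Q_def by (simp add: power_divide m_def flip: power_mult)
    moreover have "integral II_closed (\<lambda>x. (f' x / f x0)\<^sup>2) = P / m"
      unfolding P_def by (simp add: power_divide m_def)
    ultimately have "A3\<^sup>2 * (Q / m\<^sup>2 + 2 / 3) \<le> P / m" by simp
    then have "A3\<^sup>2 * (Q / m\<^sup>2 + 2 / 3) * m \<le> P" using m by (simp add: pos_le_divide_eq)
    moreover have "(Q / m\<^sup>2 + 2 / 3) * m = Q / m + 2 / 3 * m"
      using m by (simp add: distrib_right power2_eq_square)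
    ultimately have key: "A3\<^sup>2 * (Q / m + 2 / 3 * m) \<le> P" by (simp only: mult.assoc)
    have "2 / 3 * A3\<^sup>2 * m \<le> A3\<^sup>2 * (Q / m + 2 / 3 * m)"
      using m Q0 by (simp add: algebra_simps)
    then have mP: "2 / 3 * A3\<^sup>2 * m \<le> P" using key by (rule order_trans)
    \<comment> \<open>The product of the two summands is 2/3 Q, independent of m.\<close>
    have "4 * (Q / m) * (2 / 3 * m) \<le> (Q / m + 2 / 3 * m)\<^sup>2"
      using zero_le_power2[of "Q / m - 2 / 3 * m"] unfolding power2_diff power2_sum by linarith
    then have "8 / 3 * Q \<le> (Q / m + 2 / 3 * m)\<^sup>2" using m by simp
    then have "A3 ^ 4 * (8 / 3 * Q) \<le> A3 ^ 4 * (Q / m + 2 / 3 * m)\<^sup>2" by (rule mult_left_mono) simp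
    also have "\<dots> = (A3\<^sup>2 * (Q / m + 2 / 3 * m))\<^sup>2" by (simp add: power_mult_distrib flip: power_mult)
    also have "\<dots> \<le> P\<^sup>2" using key m Q0 by (intro power_mono mult_nonneg_nonneg add_nonneg_nonneg) auto
    also have "A3 ^ 4 * (8 / 3 * Q) = 4 * A3 ^ 3 * B3 * Q"
      using B3_eq by (simp add: power4_eq_xxxx power3_eq_cube)
    finally have "4 * A3 ^ 3 * B3 * Q \<le> P\<^sup>2" .
    moreover have "2 / 3 * A3\<^sup>2 * (f x)\<^sup>2 \<le> P" if "x \<in> II_closed"
    proof -
      have "(f x)\<^sup>2 \<le> m" using x0(2)[OF that] by (simp add: m_def abs_le_square_iff)
      then have "2 / 3 * A3\<^sup>2 * (f x)\<^sup>2 \<le> 2 / 3 * A3\<^sup>2 * m" by (rule mult_left_mono) simp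
      then show ?thesis using mP by (rule order_trans)
    qed
    ultimately show "4 * A3 ^ 3 * B3 * Q \<le> P\<^sup>2 \<and> (x \<in> II_closed \<longrightarrow> 2 / 3 * A3\<^sup>2 * (f x)\<^sup>2 \<le> P)" by blast
  qed
qed

section \<open>The inner product and seminorm of L2\<close>

lemma L2_I: "continuous_on II_closed f \<Longrightarrow> f \<in> L2"
  unfolding L2_def by (auto intro!: borel_measurable_integrable integrable_II continuous_intros)

lemma integrable_mult_L2:
  assumes "f \<in> L2" "g \<in> L2"
  shows "integrable (lebesgue_on II) (\<lambda>x. f x * g x)"
proof (rule Bochner_Integration.integrable_bound)
  show "integrable (lebesgue_on II) (\<lambda>x. (f x)\<^sup>2 + (g x)\<^sup>2)"
    using assms by (auto simp: L2_def)
  have [measurable]: "f \<in> borel_measurable (lebesgue_on II)" "g \<in> borel_measurable (lebesgue_on II)"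
    using assms by (auto simp: L2_def)
  show "(\<lambda>x. f x * g x) \<in> borel_measurable (lebesgue_on II)" by measurable
  have "\<bar>f x * g x\<bar> \<le> (f x)\<^sup>2 + (g x)\<^sup>2" for x
  proof -
    have "2 * (\<bar>f x\<bar> * \<bar>g x\<bar>) \<le> (f x)\<^sup>2 + (g x)\<^sup>2"
      using sum_squares_bound[of "\<bar>f x\<bar>" "\<bar>g x\<bar>"] by simp
    moreover have "0 \<le> \<bar>f x\<bar> * \<bar>g x\<bar>" by simp
    ultimately show ?thesis unfolding abs_mult by linarith
  qed
  then show "AE x in lebesgue_on II. norm (f x * g x) \<le> norm ((f x)\<^sup>2 + (g x)\<^sup>2)" by simp
qed

lemma L2_add: "f \<in> L2 \<Longrightarrow> g \<in> L2 \<Longrightarrow> (\<lambda>x. f x + g x) \<in> L2"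
  using integrable_mult_L2[of f g] by (auto simp: L2_def power2_sum mult.assoc)

lemma L2_cmult: "f \<in> L2 \<Longrightarrow> (\<lambda>x. c * f x) \<in> L2" for c :: real
  by (auto simp: L2_def power_mult_distrib)

lemma L2_diff: "f \<in> L2 \<Longrightarrow> g \<in> L2 \<Longrightarrow> (\<lambda>x. f x - g x) \<in> L2"
  using L2_add[of f "\<lambda>x. - 1 * g x"] L2_cmult[of g "- 1"] by simp

lemma L2norm_nonneg [simp]: "0 \<le> L2norm f"
  by (simp add: L2norm_def)

lemma L2norm_add_squared:
  assumes "f \<in> L2" "g \<in> L2"
  shows "(L2norm (\<lambda>x. f x + t * g x))\<^sup>2 =
    (L2norm f)\<^sup>2 + 2 * t * integral\<^sup>L (lebesgue_on II) (\<lambda>x. f x * g x) + t\<^sup>2 * (L2norm g)\<^sup>2"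
proof -
  have "integrable (lebesgue_on II) (\<lambda>x. (f x)\<^sup>2)" "integrable (lebesgue_on II) (\<lambda>x. (g x)\<^sup>2)"
    using assms by (auto simp: L2_def)
  moreover note integrable_mult_L2[OF assms]
  moreover have "(\<lambda>x. (f x + t * g x)\<^sup>2) = (\<lambda>x. (f x)\<^sup>2 + 2 * t * (f x * g x) + t\<^sup>2 * (g x)\<^sup>2)"
    by (auto simp: power2_eq_square algebra_simps)
  ultimately show ?thesis by (simp add: L2norm_squared)
qed

lemma L2_Cauchy_Schwarz:
  assumes "f \<in> L2" "g \<in> L2"
  shows "\<bar>integral\<^sup>L (lebesgue_on II) (\<lambda>x. f x * g x)\<bar> \<le> L2norm f * L2norm g"
proof -
  let ?H = "integral\<^sup>L (lebesgue_on II) (\<lambda>x. f x * g x)"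
  have q: "0 \<le> (L2norm f)\<^sup>2 + 2 * t * ?H + t\<^sup>2 * (L2norm g)\<^sup>2" for t
    unfolding L2norm_add_squared[OF assms, symmetric] by simp
  have "?H\<^sup>2 \<le> (L2norm f)\<^sup>2 * (L2norm g)\<^sup>2"
  proof (cases "L2norm g = 0")
    case True
    have "?H = 0"
    proof (rule ccontr)
      assume "?H \<noteq> 0"
      \<comment> \<open>For this t the quadratic, whose leading coefficient is 0, takes the value
        -1.\<close>
      then show False using q[of "- ((L2norm f)\<^sup>2 + 1) / (2 * ?H)"] True by (simp add: field_simps)
    qed
    then show ?thesis by simp
  next
    case False
    define G where "G = (L2norm g)\<^sup>2"
    have "0 < G" using False by (simp add: G_def)
    \<comment> \<open>The quadratic is evaluated at its minimum point.\<close>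
    then show ?thesis
      using q[of "- ?H / G"] unfolding G_def[symmetric] by (simp add: field_simps power2_eq_square)
  qed
  then have "?H\<^sup>2 \<le> (L2norm f * L2norm g)\<^sup>2" by (simp add: power_mult_distrib)
  then show ?thesis by (rule abs_le_square_iff[THEN iffD2, THEN order_trans]) simp
qed

lemma L2norm_triangle:
  assumes "f \<in> L2" "g \<in> L2"
  shows "L2norm (\<lambda>x. f x + g x) \<le> L2norm f + L2norm g"
proof (rule power2_le_imp_le)
  show "(L2norm (\<lambda>x. f x + g x))\<^sup>2 \<le> (L2norm f + L2norm g)\<^sup>2"
    using L2norm_add_squared[OF assms, of 1] L2_Cauchy_Schwarz[OF assms] by (simp add: power2_sum)
qed simp

lemma L2norm_diff_commute: "L2norm (\<lambda>x. f x - g x) = L2norm (\<lambda>x. g x - f x)"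
  by (simp add: L2norm_def power2_commute)

section \<open>Test functions and the inequality on H01\<close>

lemma test_function_differentiable: "\<phi> \<in> test_functions \<Longrightarrow> (deriv ^^ k) \<phi> differentiable at x"
  by (simp add: test_functions_def)

lemma test_function_DERIV: "\<phi> \<in> test_functions \<Longrightarrow> (\<phi> has_real_derivative deriv \<phi> x) (at x)"
  using test_function_differentiable[of \<phi> 0 x] by (simp add: DERIV_deriv_iff_real_differentiable)

lemma test_function_deriv:
  assumes "\<phi> \<in> test_functions"
  shows "deriv \<phi> \<in> test_functions"
proof -
  obtain K where K: "compact K" "K \<subseteq> II" "\<And>x. x \<notin> K \<Longrightarrow> \<phi> x = 0"
    using assms by (auto simp: test_functions_def)
  have "deriv \<phi> x = 0" if "x \<notin> K" for x
  proof -
    have "open (- K)" using K(1) by (simp add: compact_imp_closed open_Compl)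
    then have "((\<lambda>x. 0) has_real_derivative deriv \<phi> x) (at x)"
      by (rule has_field_derivative_transform_within_open[OF test_function_DERIV[OF assms]])
        (use that K(3) in auto)
    then show ?thesis using DERIV_const DERIV_unique by blast
  qed
  moreover have "(deriv ^^ k) (deriv \<phi>) differentiable at x" for k x
    using test_function_differentiable[OF assms, of "Suc k" x] by (simp add: funpow_swap1)
  ultimately show ?thesis using K(1,2) unfolding test_functions_def by blast
qed

lemma test_function_continuous: "\<phi> \<in> test_functions \<Longrightarrow> continuous_on S \<phi>"
  using test_function_DERIV by (meson DERIV_isCont continuous_at_imp_continuous_on)

lemma test_function_boundary:
  assumes "\<phi> \<in> test_functions" shows "\<phi> (-1) = 0" "\<phi> 1 = 0"
proof -
  obtain K where "K \<subseteq> II" "\<And>x. x \<notin> K \<Longrightarrow> \<phi> x = 0"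
    using assms by (auto simp: test_functions_def)
  moreover from this have "-1 \<notin> K" "1 \<notin> K" by auto
  ultimately show "\<phi> (-1) = 0" "\<phi> 1 = 0" by auto
qed

lemma test_function_L2: "\<phi> \<in> test_functions \<Longrightarrow> \<phi> \<in> L2"
  by (intro L2_I test_function_continuous)

lemma test_function_cmult:
  assumes "\<phi> \<in> test_functions"
  shows "(\<lambda>x. c * \<phi> x) \<in> test_functions"
proof -
  note d = test_function_differentiable[OF assms]
  have "(deriv ^^ k) (\<lambda>x. c * \<phi> x) = (\<lambda>x. c * (deriv ^^ k) \<phi> x)" for k
  proof (induction k)
    case (Suc k)
    have "deriv (\<lambda>x. c * (deriv ^^ k) \<phi> x) x = c * deriv ((deriv ^^ k) \<phi>) x" for x
      using d[of k x] by (intro DERIV_imp_deriv DERIV_cmult) (simp add: DERIV_deriv_iff_real_differentiable)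
    then show ?case by (simp add: Suc)
  qed simp
  then have "(deriv ^^ k) (\<lambda>x. c * \<phi> x) differentiable at x" for k x
    using d[of k x] by (simp add: differentiable_mult)
  moreover have "\<exists>K. compact K \<and> K \<subseteq> II \<and> (\<forall>x. x \<notin> K \<longrightarrow> c * \<phi> x = 0)"
    using assms by (auto simp: test_functions_def)
  ultimately show ?thesis by (simp add: test_functions_def)
qed

text \<open>Integration by parts; the compact supports kill the boundary terms.\<close>

lemma test_function_weak_deriv:
  assumes "\<phi> \<in> test_functions"
  shows "has_weak_deriv \<phi> (deriv \<phi>)"
  unfolding has_weak_deriv_def
proof (intro conjI ballI)
  fix \<psi> assume \<psi>: "\<psi> \<in> test_functions"
  note cont [continuous_intros] = test_function_continuous[OF assms] test_function_continuous[OF \<psi>]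
    test_function_continuous[OF test_function_deriv[OF assms]]
    test_function_continuous[OF test_function_deriv[OF \<psi>]]
  have "((\<lambda>x. \<phi> x * deriv \<psi> x + deriv \<phi> x * \<psi> x) has_integral \<phi> 1 * \<psi> 1 - \<phi> (-1) * \<psi> (-1)) II_closed"
  proof (rule fundamental_theorem_of_calculus)
    fix x
    have "((\<lambda>x. \<phi> x * \<psi> x) has_real_derivative \<phi> x * deriv \<psi> x + deriv \<phi> x * \<psi> x) (at x)"
      using DERIV_mult[OF test_function_DERIV[OF assms, of x] test_function_DERIV[OF \<psi>, of x]]
      by (simp add: algebra_simps)
    then show "((\<lambda>x. \<phi> x * \<psi> x) has_vector_derivative \<phi> x * deriv \<psi> x + deriv \<phi> x * \<psi> x) (at x within II_closed)"
      by (simp add: has_field_derivative_at_within flip: has_real_derivative_iff_has_vector_derivative)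
  qed simp
  then have "integral II_closed (\<lambda>x. \<phi> x * deriv \<psi> x + deriv \<phi> x * \<psi> x) = 0"
    using test_function_boundary[OF assms] by (simp add: integral_unique)
  moreover have "integral II_closed (\<lambda>x. \<phi> x * deriv \<psi> x + deriv \<phi> x * \<psi> x) =
      integral II_closed (\<lambda>x. \<phi> x * deriv \<psi> x) + integral II_closed (\<lambda>x. deriv \<phi> x * \<psi> x)"
    by (intro Henstock_Kurzweil_Integration.integral_add integrable_continuous_real continuous_intros)
  moreover have "integral\<^sup>L (lebesgue_on II) (\<lambda>x. \<phi> x * deriv \<psi> x) = integral II_closed (\<lambda>x. \<phi> x * deriv \<psi> x)"
    "integral\<^sup>L (lebesgue_on II) (\<lambda>x. deriv \<phi> x * \<psi> x) = integral II_closed (\<lambda>x. deriv \<phi> x * \<psi> x)"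
    by (intro integral_II continuous_intros)+
  ultimately show "integral\<^sup>L (lebesgue_on II) (\<lambda>x. \<phi> x * deriv \<psi> x) = - integral\<^sup>L (lebesgue_on II) (\<lambda>x. deriv \<phi> x * \<psi> x)"
    by simp
qed (intro test_function_L2 test_function_deriv assms)+

lemma test_function_H01: "\<phi> \<in> test_functions \<Longrightarrow> \<phi> \<in> H01"
  using test_function_weak_deriv[of \<phi>] unfolding H01_def
  by (auto intro!: exI[of _ "deriv \<phi>"] bexI[of _ \<phi>] simp: L2norm_def)

lemma test_function_sharp_ineq:
  assumes "\<phi> \<in> test_functions"
  shows "4 * A3 ^ 3 * B3 * integral\<^sup>L (lebesgue_on II) (\<lambda>x. \<phi> x ^ 4) \<le> L2norm (deriv \<phi>) ^ 4"
    and "x \<in> II_closed \<Longrightarrow> (\<phi> x)\<^sup>2 \<le> 3 / (2 * A3\<^sup>2) * (L2norm (deriv \<phi>))\<^sup>2"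
proof -
  have c: "continuous_on S \<phi>" "continuous_on S (deriv \<phi>)" for S
    using assms by (auto intro: test_function_continuous test_function_deriv)
  note s = sharp_ineq[OF test_function_DERIV[OF assms] c(2) test_function_boundary[OF assms]]
  have P: "integral II_closed (\<lambda>x. (deriv \<phi> x)\<^sup>2) = (L2norm (deriv \<phi>))\<^sup>2"
    unfolding L2norm_squared by (intro integral_II[symmetric] continuous_intros c)
  have Q: "integral II_closed (\<lambda>x. \<phi> x ^ 4) = integral\<^sup>L (lebesgue_on II) (\<lambda>x. \<phi> x ^ 4)"
    by (intro integral_II[symmetric] continuous_intros c)
  show "4 * A3 ^ 3 * B3 * integral\<^sup>L (lebesgue_on II) (\<lambda>x. \<phi> x ^ 4) \<le> L2norm (deriv \<phi>) ^ 4"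
    using s(1) unfolding P Q by (simp flip: power_mult)
  show "(\<phi> x)\<^sup>2 \<le> 3 / (2 * A3\<^sup>2) * (L2norm (deriv \<phi>))\<^sup>2" if "x \<in> II_closed"
    using s(2)[OF that] A3_pos unfolding P by (simp add: field_simps)
qed

text \<open>The inequality holds for approximating test functions. A subsequence converges almost
  everywhere, and the bound of the maximum norm by the Dirichlet integral dominates the fourth
  powers, so the integral of u^4 passes to the limit. The derivative norms are controlled through
  \<open>g0\<close>, the weak derivative belonging to the approximation.\<close>

lemma H01_sharp_ineq:
  assumes u: "u \<in> H01" and g: "has_weak_deriv u g"
    and u4: "integral\<^sup>L (lebesgue_on II) (\<lambda>x. u x ^ 4) = 1"
  shows "4 * A3 ^ 3 * B3 \<le> L2norm g ^ 4"
proof -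
  obtain g0 where g0: "has_weak_deriv u g0" and
    approx: "\<And>\<epsilon>. 0 < \<epsilon> \<Longrightarrow> \<exists>\<phi>\<in>test_functions.
        sqrt ((L2norm (\<lambda>x. u x - \<phi> x))\<^sup>2 + (L2norm (\<lambda>x. g0 x - deriv \<phi> x))\<^sup>2) < \<epsilon>"
    using u by (auto simp: H01_def)
  define e where "e n = 1 / real (Suc n)" for n
  have e: "0 < e n" "e n \<le> 1" for n by (auto simp: e_def)
  have e0: "e \<longlonglongrightarrow> 0"
    using LIMSEQ_inverse_real_of_nat by (simp add: e_def[abs_def] inverse_eq_divide)
  have "\<forall>n. \<exists>\<phi>. \<phi> \<in> test_functions \<and>
      sqrt ((L2norm (\<lambda>x. u x - \<phi> x))\<^sup>2 + (L2norm (\<lambda>x. g0 x - deriv \<phi> x))\<^sup>2) < e n"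
    using approx e(1) by blast
  then obtain \<phi> where \<phi>: "\<And>n. \<phi> n \<in> test_functions" and
    \<phi>e: "\<And>n. sqrt ((L2norm (\<lambda>x. u x - \<phi> n x))\<^sup>2 + (L2norm (\<lambda>x. g0 x - deriv (\<phi> n) x))\<^sup>2) < e n"
    by metis
  have close: "L2norm (\<lambda>x. u x - \<phi> n x) \<le> e n" "L2norm (\<lambda>x. g0 x - deriv (\<phi> n) x) \<le> e n" for n
    using \<phi>e[of n] real_sqrt_sum_squares_ge1 real_sqrt_sum_squares_ge2 order_trans less_imp_le by meson+
  note \<phi>' = test_function_deriv[OF \<phi>]
  have L2: "u \<in> L2" "g \<in> L2" "g0 \<in> L2" using g g0 by (auto simp: has_weak_deriv_def)
  have \<phi>L2: "\<phi> n \<in> L2" "deriv (\<phi> n) \<in> L2" for n using \<phi> \<phi>' by (auto intro: test_function_L2)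
  have deriv_le: "L2norm (deriv (\<phi> n)) \<le> L2norm g0 + e n" for n
  proof -
    have "L2norm (\<lambda>x. g0 x + (deriv (\<phi> n) x - g0 x)) \<le> L2norm g0 + L2norm (\<lambda>x. deriv (\<phi> n) x - g0 x)"
      by (intro L2norm_triangle L2_diff L2 \<phi>L2)
    moreover have "L2norm (\<lambda>x. deriv (\<phi> n) x - g0 x) \<le> e n"
      using close(2)[of n] by (subst L2norm_diff_commute)
    ultimately show ?thesis by simp
  qed

  txt \<open>Two weak derivatives have the same pairing with test functions, in particular with
    the derivatives approximating \<open>g0\<close>; this avoids their uniqueness.\<close>
  have "L2norm g0 \<le> L2norm g"
  proof -
    \<comment> \<open>As the error tends to 0 this becomes |g0|^2 <= |g| |g0|.\<close>
    have "(L2norm g0)\<^sup>2 \<le> L2norm g * (L2norm g0 + e n) + L2norm g0 * e n" for n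
    proof -
      have "(L2norm g0)\<^sup>2 = integral\<^sup>L (lebesgue_on II) (\<lambda>x. g0 x * deriv (\<phi> n) x + g0 x * (g0 x - deriv (\<phi> n) x))"
        unfolding L2norm_squared by (simp add: algebra_simps power2_eq_square)
      also have "\<dots> = integral\<^sup>L (lebesgue_on II) (\<lambda>x. g0 x * deriv (\<phi> n) x)
          + integral\<^sup>L (lebesgue_on II) (\<lambda>x. g0 x * (g0 x - deriv (\<phi> n) x))"
        by (intro Bochner_Integration.integral_add integrable_mult_L2 L2_diff L2 \<phi>L2)
      also have "integral\<^sup>L (lebesgue_on II) (\<lambda>x. g0 x * deriv (\<phi> n) x)
          = integral\<^sup>L (lebesgue_on II) (\<lambda>x. g x * deriv (\<phi> n) x)"
        using g g0 \<phi>'[of n] unfolding has_weak_deriv_def by force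
      also have "integral\<^sup>L (lebesgue_on II) (\<lambda>x. g x * deriv (\<phi> n) x) \<le> L2norm g * L2norm (deriv (\<phi> n))"
        using L2_Cauchy_Schwarz[OF L2(2) \<phi>L2(2)] abs_ge_self order_trans by blast
      also have "\<dots> \<le> L2norm g * (L2norm g0 + e n)" by (intro mult_left_mono deriv_le) simp
      also have "integral\<^sup>L (lebesgue_on II) (\<lambda>x. g0 x * (g0 x - deriv (\<phi> n) x)) \<le> L2norm g0 * L2norm (\<lambda>x. g0 x - deriv (\<phi> n) x)"
        using L2_Cauchy_Schwarz[OF L2(3) L2_diff[OF L2(3) \<phi>L2(2)]] abs_ge_self order_trans by blast
      also have "\<dots> \<le> L2norm g0 * e n" by (intro mult_left_mono close) simp
      finally show ?thesis by simp
    qed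
    moreover have "(\<lambda>n. L2norm g * (L2norm g0 + e n) + L2norm g0 * e n)
        \<longlonglongrightarrow> L2norm g * (L2norm g0 + 0) + L2norm g0 * 0"
      by (intro tendsto_intros e0)
    ultimately have "(L2norm g0)\<^sup>2 \<le> L2norm g * (L2norm g0 + 0) + L2norm g0 * 0"
      by (intro LIMSEQ_le_const) auto
    then have "L2norm g0 * L2norm g0 \<le> L2norm g * L2norm g0" by (simp add: power2_eq_square)
    then show ?thesis using L2norm_nonneg[of g0] L2norm_nonneg[of g]
      by (metis less_eq_real_def mult_right_le_imp_le)
  qed

  have one: "(\<lambda>x. 1) \<in> L2" by (intro L2_I continuous_intros)
  define D where "D n x = u x - \<phi> n x" for n x
  have DL2: "D n \<in> L2" for n unfolding D_def[abs_def] by (intro L2_diff L2 \<phi>L2)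
  \<comment> \<open>Pairing with the constant 1 turns L2 convergence into L1 convergence, from which
    an almost everywhere convergent subsequence is extracted.\<close>
  have L1: "norm (integral\<^sup>L (lebesgue_on II) (\<lambda>x. norm (D n x))) \<le> e n * L2norm (\<lambda>x. 1)" for n
  proof -
    have "(\<lambda>x. \<bar>D n x\<bar>) \<in> L2" using DL2[of n] by (auto simp: L2_def)
    from L2_Cauchy_Schwarz[OF this one]
    have "integral\<^sup>L (lebesgue_on II) (\<lambda>x. \<bar>D n x\<bar>) \<le> L2norm (D n) * L2norm (\<lambda>x. 1)"
      by (simp add: L2norm_def)
    also have "\<dots> \<le> e n * L2norm (\<lambda>x. 1)"
      using close(1)[of n] by (intro mult_right_mono) (auto simp: D_def[abs_def])
    finally show ?thesis by simp
  qed
  have "(\<lambda>n. integral\<^sup>L (lebesgue_on II) (\<lambda>x. norm (D n x))) \<longlonglongrightarrow> 0"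
    by (rule Lim_null_comparison[OF always_eventually tendsto_mult_left_zero[OF e0]]) (use L1 in blast)
  moreover have "integrable (lebesgue_on II) (D n)" for n
    using integrable_mult_L2[OF DL2 one] by simp
  ultimately obtain r where r: "strict_mono r" "AE x in lebesgue_on II. (\<lambda>n. D (r n) x) \<longlonglongrightarrow> 0"
    using tendsto_L1_AE_subseq[of "lebesgue_on II" D] by blast
  \<comment> \<open>The Sobolev bound with |g0| + 1 for the derivative norm, uniform in n because
    all errors are at most 1.\<close>
  define M where "M = 3 / (2 * A3\<^sup>2) * (L2norm g0 + 1)\<^sup>2"
  have bound: "(\<phi> n x)\<^sup>2 \<le> M" if "x \<in> II" for n x
  proof -
    have "(\<phi> n x)\<^sup>2 \<le> 3 / (2 * A3\<^sup>2) * (L2norm (deriv (\<phi> n)))\<^sup>2"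
      using that by (intro test_function_sharp_ineq \<phi>) auto
    also have "\<dots> \<le> M"
      unfolding M_def using deriv_le[of n] e(2)[of n] by (intro mult_left_mono power_mono) auto
    finally show ?thesis .
  qed
  have [measurable]: "u \<in> borel_measurable (lebesgue_on II)" "\<phi> n \<in> borel_measurable (lebesgue_on II)" for n
    using L2 \<phi>L2 by (auto simp: L2_def)
  have "(\<lambda>n. integral\<^sup>L (lebesgue_on II) (\<lambda>x. \<phi> (r n) x ^ 4)) \<longlonglongrightarrow> integral\<^sup>L (lebesgue_on II) (\<lambda>x. u x ^ 4)"
  proof (rule integral_dominated_convergence)
    show "(\<lambda>x. u x ^ 4) \<in> borel_measurable (lebesgue_on II)"
      "(\<lambda>x. \<phi> (r n) x ^ 4) \<in> borel_measurable (lebesgue_on II)" for n by measurable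
    show "integrable (lebesgue_on II) (\<lambda>x. M\<^sup>2)" by (intro integrable_II continuous_intros)
    show "AE x in lebesgue_on II. (\<lambda>n. \<phi> (r n) x ^ 4) \<longlonglongrightarrow> u x ^ 4"
      using r(2)
    proof eventually_elim
      fix x assume "(\<lambda>n. D (r n) x) \<longlonglongrightarrow> 0"
      from tendsto_diff[OF tendsto_const[of "u x"] this] have "(\<lambda>n. \<phi> (r n) x) \<longlonglongrightarrow> u x"
        by (simp add: D_def)
      then show "(\<lambda>n. \<phi> (r n) x ^ 4) \<longlonglongrightarrow> u x ^ 4" by (rule tendsto_power)
    qed
    show "AE x in lebesgue_on II. norm (\<phi> (r n) x ^ 4) \<le> M\<^sup>2" for n
    proof (rule AE_I2)
      fix x assume "x \<in> space (lebesgue_on II)"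
      then have "((\<phi> (r n) x)\<^sup>2)\<^sup>2 \<le> M\<^sup>2" using bound by (intro power_mono) auto
      then show "norm (\<phi> (r n) x ^ 4) \<le> M\<^sup>2" by (simp flip: power_mult)
    qed
  qed
  then have lim: "(\<lambda>n. 4 * A3 ^ 3 * B3 * integral\<^sup>L (lebesgue_on II) (\<lambda>x. \<phi> (r n) x ^ 4))
      \<longlonglongrightarrow> 4 * A3 ^ 3 * B3 * 1"
    unfolding u4 by (intro tendsto_intros)
  have "(\<lambda>n. e (r n)) \<longlonglongrightarrow> 0"
    using LIMSEQ_subseq_LIMSEQ[OF e0 r(1)] by (simp add: comp_def)
  then have lim': "(\<lambda>n. (L2norm g0 + e (r n)) ^ 4) \<longlonglongrightarrow> (L2norm g0 + 0) ^ 4"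
    by (intro tendsto_intros)
  have "4 * A3 ^ 3 * B3 * integral\<^sup>L (lebesgue_on II) (\<lambda>x. \<phi> n x ^ 4) \<le> (L2norm g0 + e n) ^ 4" for n
  proof -
    have "4 * A3 ^ 3 * B3 * integral\<^sup>L (lebesgue_on II) (\<lambda>x. \<phi> n x ^ 4) \<le> L2norm (deriv (\<phi> n)) ^ 4"
      by (intro test_function_sharp_ineq \<phi>)
    also have "\<dots> \<le> (L2norm g0 + e n) ^ 4" by (intro power_mono deriv_le) simp
    finally show ?thesis .
  qed
  then have "4 * A3 ^ 3 * B3 * 1 \<le> (L2norm g0 + 0) ^ 4"
    by (intro LIMSEQ_le[OF lim lim']) auto
  also have "\<dots> \<le> L2norm g ^ 4" using \<open>L2norm g0 \<le> L2norm g\<close> by (intro power_mono) auto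
  finally show ?thesis by simp
qed

section \<open>A minimizing sequence of test functions\<close>

text \<open>An explicit derivative at each stage lets the rules for sums, products and compositions
  be proved by induction on the order, which iterating \<open>deriv\<close> would obscure.\<close>

primrec times_differentiable :: "nat \<Rightarrow> (real \<Rightarrow> real) \<Rightarrow> bool" where
  "times_differentiable 0 f \<longleftrightarrow> True"
| "times_differentiable (Suc k) f \<longleftrightarrow>
    (\<exists>f'. (\<forall>x. (f has_real_derivative f' x) (at x)) \<and> times_differentiable k f')"

lemma times_differentiable_SucI:
  assumes "\<And>x. (f has_real_derivative f' x) (at x)" "times_differentiable k f'"
  shows "times_differentiable (Suc k) f"
  using assms by auto

lemma times_differentiable_mono: "times_differentiable (Suc k) f \<Longrightarrow> times_differentiable k f"
  by (induction k arbitrary: f) auto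

lemma times_differentiable_const: "times_differentiable k (\<lambda>x. c)"
proof (induction k arbitrary: c)
  case (Suc k)
  show ?case by (rule times_differentiable_SucI[OF DERIV_const Suc])
qed simp

lemma times_differentiable_add:
  "times_differentiable k f \<Longrightarrow> times_differentiable k g \<Longrightarrow> times_differentiable k (\<lambda>x. f x + g x)"
proof (induction k arbitrary: f g)
  case (Suc k)
  then obtain f' g' where "\<And>x. (f has_real_derivative f' x) (at x)" "times_differentiable k f'"
    "\<And>x. (g has_real_derivative g' x) (at x)" "times_differentiable k g'" by auto
  then show ?case by (intro times_differentiable_SucI[OF DERIV_add] Suc.IH)
qed simp

lemma times_differentiable_mult:
  "times_differentiable k f \<Longrightarrow> times_differentiable k g \<Longrightarrow> times_differentiable k (\<lambda>x. f x * g x)"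
proof (induction k arbitrary: f g)
  case (Suc k)
  then obtain f' g' where *: "\<And>x. (f has_real_derivative f' x) (at x)" "times_differentiable k f'"
    "\<And>x. (g has_real_derivative g' x) (at x)" "times_differentiable k g'" by auto
  show ?case
    by (rule times_differentiable_SucI[OF DERIV_mult[OF *(1,3)]])
      (intro *(2,4) Suc.IH times_differentiable_add times_differentiable_mono[OF Suc.prems(1)]
        times_differentiable_mono[OF Suc.prems(2)])
qed simp

lemma times_differentiable_power:
  "times_differentiable k f \<Longrightarrow> times_differentiable k (\<lambda>x. f x ^ n)"
  by (induction n) (auto intro: times_differentiable_const times_differentiable_mult)

lemma times_differentiable_compose:
  "times_differentiable k f \<Longrightarrow> times_differentiable k g \<Longrightarrow> times_differentiable k (\<lambda>x. f (g x))"
proof (induction k arbitrary: f g)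
  case (Suc k)
  then obtain f' g' where *: "\<And>x. (f has_real_derivative f' x) (at x)" "times_differentiable k f'"
    "\<And>x. (g has_real_derivative g' x) (at x)" "times_differentiable k g'" by auto
  show ?case
    by (rule times_differentiable_SucI[OF DERIV_chain2[OF *(1,3)]])
      (rule times_differentiable_mult[OF Suc.IH[OF *(2) times_differentiable_mono[OF Suc.prems(2)]] *(4)])
qed simp

lemma times_differentiable_id: "times_differentiable k (\<lambda>x. x)"
proof (cases k)
  case (Suc j)
  show ?thesis unfolding Suc by (rule times_differentiable_SucI[OF DERIV_ident times_differentiable_const])
qed simp

text \<open>The bridge to the iterated \<open>deriv\<close> in the definition of test
  functions.\<close>

lemma times_differentiable_deriv:
  "times_differentiable (Suc (j + k)) f \<Longrightarrow> times_differentiable (Suc k) ((deriv ^^ j) f)"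
proof (induction j arbitrary: f)
  case (Suc j)
  then obtain f' where "\<And>x. (f has_real_derivative f' x) (at x)" "times_differentiable (Suc (j + k)) f'"
    by auto
  moreover from this have "deriv f = f'" by (auto intro: DERIV_imp_deriv)
  ultimately show ?case using Suc.IH[of f'] by (simp add: funpow_swap1 del: times_differentiable.simps)
qed simp

text \<open>On the open set U the derivative vanishes together with f, so the induction passes to
  the derivative with the same U. The sets U, the open interval and the complement of the closed one
  are open and cover the line, so there is no seam to inspect.\<close>

lemma times_differentiable_cutoff:
  assumes U: "open U" "-1 \<in> U" "1 \<in> U" and "times_differentiable k f" "\<And>x. x \<in> U \<Longrightarrow> f x = 0"
  shows "times_differentiable k (\<lambda>x. if x \<in> II_closed then f x else 0)"
  using assms(4,5)
proof (induction k arbitrary: f)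
  case (Suc k)
  then obtain f' where f': "\<And>x. (f has_real_derivative f' x) (at x)" "times_differentiable k f'" by auto
  have zero: "f' x = 0" if "x \<in> U" for x
  proof -
    have "((\<lambda>x. 0) has_real_derivative f' x) (at x)"
      by (rule has_field_derivative_transform_within_open[OF f'(1) U(1) that]) (rule Suc.prems(2))
    then show ?thesis using DERIV_const DERIV_unique by blast
  qed
  show ?case
  proof (rule times_differentiable_SucI)
    show "times_differentiable k (\<lambda>x. if x \<in> II_closed then f' x else 0)"
      by (rule Suc.IH[OF f'(2) zero])
    fix x
    consider "x \<in> U" | "x \<in> II" | "x \<in> - II_closed"
      using U(2,3) by fastforce
    then show "((\<lambda>x. if x \<in> II_closed then f x else 0) has_real_derivative
        (if x \<in> II_closed then f' x else 0)) (at x)"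
    proof cases
      case 1
      have "((\<lambda>x. if x \<in> II_closed then f x else 0) has_real_derivative 0) (at x)"
        by (rule has_field_derivative_transform_within_open[OF DERIV_const[of 0] U(1) 1])
          (use Suc.prems(2) in auto)
      then show ?thesis using zero[OF 1] by simp
    next
      case 2
      then show ?thesis
        using has_field_derivative_transform_within_open[OF f'(1) _ 2,
            of "\<lambda>x. if x \<in> II_closed then f x else 0"] by auto
    next
      case 3
      have "((\<lambda>x. if x \<in> II_closed then f x else 0) has_real_derivative 0) (at x)"
        by (rule has_field_derivative_transform_within_open[OF DERIV_const[of 0] _ 3]) auto
      then show ?thesis using 3 by auto
    qed
  qed
qed simp

lemma test_function_cutoff:
  assumes U: "open U" "-1 \<in> U" "1 \<in> U" and f: "\<And>k. times_differentiable k f" "\<And>x. x \<in> U \<Longrightarrow> f x = 0"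
  shows "(\<lambda>x. if x \<in> II_closed then f x else 0) \<in> test_functions" (is "?\<phi> \<in> _")
  unfolding test_functions_def
proof (intro CollectI conjI allI)
  fix k x
  have "times_differentiable (Suc (k + 0)) ?\<phi>" by (intro times_differentiable_cutoff[OF U] f)
  then have "times_differentiable (Suc 0) ((deriv ^^ k) ?\<phi>)" by (rule times_differentiable_deriv)
  then show "(deriv ^^ k) ?\<phi> differentiable at x" by (auto simp: real_differentiable_def)
next
  have "compact (II_closed - U)" using U(1) by (intro compact_diff) auto
  moreover have "II_closed - U \<subseteq> II"
  proof
    fix x assume "x \<in> II_closed - U"
    moreover from this have "x \<noteq> -1" "x \<noteq> 1" using U by auto
    ultimately show "x \<in> II" by auto
  qed
  ultimately show "\<exists>K. compact K \<and> K \<subseteq> II \<and> (\<forall>x. x \<notin> K \<longrightarrow> ?\<phi> x = 0)"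
    using f(2) by (intro exI[of _ "II_closed - U"]) auto
qed

section \<open>Smooth flat functions and a smooth ramp\<close>

text \<open>The classical flat function exp (- 1 / t) divided by powers of t: the linear span of
  these functions is closed under differentiation.\<close>

definition flat :: "nat \<Rightarrow> real \<Rightarrow> real" where
  "flat n t = (if 0 < t then exp (- (1 / t)) / t ^ n else 0)"

text \<open>From (1 + y / N)^N <= exp y with y = 1 / t and N = n + 2. The two extra powers give a
  bound quadratic in t, so the difference quotient at 0 tends to 0.\<close>

lemma flat_bound: "\<bar>flat n t\<bar> \<le> real (n + 2) ^ (n + 2) * t\<^sup>2"
proof (cases "0 < t")
  case True
  have "(1 / t / real (n + 2)) ^ (n + 2) \<le> (1 + 1 / t / real (n + 2)) ^ (n + 2)"
    using True by (intro power_mono) auto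
  also have "\<dots> \<le> exp (1 / t)"
    using True by (intro exp_ge_one_plus_x_over_n_power_n) (auto intro: order_trans[of _ 0])
  finally have "(1 / t) ^ (n + 2) / real (n + 2) ^ (n + 2) \<le> exp (1 / t)"
    by (simp only: power_divide)
  then have "(1 / t) ^ (n + 2) \<le> exp (1 / t) * real (n + 2) ^ (n + 2)"
    by (simp only: pos_divide_le_eq[OF zero_less_power] of_nat_0_less_iff add_pos_pos zero_less_numeral add_gr_0 simp_thms)
  then have "(1 / t) ^ (n + 2) * exp (- (1 / t)) \<le> exp (1 / t) * real (n + 2) ^ (n + 2) * exp (- (1 / t))"
    by (rule mult_right_mono) simp
  also have "\<dots> = real (n + 2) ^ (n + 2)" by (simp add: exp_minus)
  finally have "(1 / t) ^ (n + 2) * exp (- (1 / t)) \<le> real (n + 2) ^ (n + 2)" .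
  then have "(1 / t) ^ (n + 2) * exp (- (1 / t)) * t\<^sup>2 \<le> real (n + 2) ^ (n + 2) * t\<^sup>2"
    by (rule mult_right_mono) simp
  moreover have "(1 / t) ^ (n + 2) * exp (- (1 / t)) * t\<^sup>2 = flat n t"
    using True by (simp add: flat_def power_add power_divide power2_eq_square)
  moreover have "0 \<le> flat n t" by (simp add: flat_def)
  ultimately show ?thesis by simp
qed (simp add: flat_def)

lemma DERIV_flat:
  "(flat n has_real_derivative flat (n + 2) t - real n * flat (n + 1) t) (at t)"
proof -
  consider "0 < t" | "t < 0" | "t = 0" by linarith
  then show ?thesis
  proof cases
    case 1
    have "((\<lambda>t. exp (- (1 / t)) / t ^ n) has_real_derivative
        (exp (- (1 / t)) * (1 / t\<^sup>2) * t ^ n - exp (- (1 / t)) * (real n * t ^ (n - 1))) / (t ^ n)\<^sup>2) (at t)"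
      using 1 by (auto intro!: derivative_eq_intros simp: power2_eq_square)
    moreover have "(exp (- (1 / t)) * (1 / t\<^sup>2) * t ^ n - exp (- (1 / t)) * (real n * t ^ (n - 1))) / (t ^ n)\<^sup>2
        = flat (n + 2) t - real n * flat (n + 1) t"
      using 1 by (cases n) (auto simp: flat_def field_simps power2_eq_square)
    ultimately have "((\<lambda>t. exp (- (1 / t)) / t ^ n) has_real_derivative flat (n + 2) t - real n * flat (n + 1) t) (at t)"
      by simp
    then show ?thesis
      by (rule has_field_derivative_transform_within_open[where S = "{0<..}"]) (use 1 in \<open>auto simp: flat_def\<close>)
  next
    case 2
    have "(flat n has_real_derivative 0) (at t)"
      by (rule has_field_derivative_transform_within_open[OF DERIV_const[of 0], where S = "{..<0}"])
        (use 2 in \<open>auto simp: flat_def\<close>)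
    then show ?thesis using 2 by (simp add: flat_def)
  next
    case 3
    have "((\<lambda>h. flat n h / h) \<longlongrightarrow> 0) (at 0)"
    proof (rule Lim_null_comparison)
      show "\<forall>\<^sub>F h in at 0. norm (flat n h / h) \<le> real (n + 2) ^ (n + 2) * \<bar>h\<bar>"
      proof (rule always_eventually, rule allI)
        fix h show "norm (flat n h / h) \<le> real (n + 2) ^ (n + 2) * \<bar>h\<bar>"
          using flat_bound[of n h]
          by (cases "h = 0") (auto simp: abs_divide pos_divide_le_eq mult.assoc power2_eq_square)
      qed
      have "((\<lambda>h::real. real (n + 2) ^ (n + 2) * \<bar>h\<bar>) \<longlongrightarrow> real (n + 2) ^ (n + 2) * \<bar>0\<bar>) (at 0)"
        by (intro tendsto_intros)
      then show "((\<lambda>h::real. real (n + 2) ^ (n + 2) * \<bar>h\<bar>) \<longlongrightarrow> 0) (at 0)" by simp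
    qed
    then have "(flat n has_real_derivative 0) (at 0)"
      by (simp add: DERIV_def flat_def)
    then show ?thesis using 3 by (simp add: flat_def)
  qed
qed

lemma times_differentiable_flat: "times_differentiable k (flat n)"
proof (induction k arbitrary: n)
  case (Suc k)
  have "times_differentiable k (\<lambda>t. flat (n + 2) t + (- real n) * flat (n + 1) t)"
    by (intro times_differentiable_add times_differentiable_mult times_differentiable_const Suc)
  with DERIV_flat[of n] show ?case by (intro times_differentiable_SucI) auto
qed simp

text \<open>A smooth substitute for the positive part whose slope stays below 1, so that composing with it
  does not increase the Dirichlet integral.\<close>

definition soft_ramp :: "real \<Rightarrow> real" where
  "soft_ramp t = t * flat 0 t"

lemma DERIV_soft_ramp: "(soft_ramp has_real_derivative flat 0 t + flat 1 t) (at t)"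
proof -
  have "(soft_ramp has_real_derivative 1 * flat 0 t + (flat (0 + 2) t - real 0 * flat (0 + 1) t) * t) (at t)"
    unfolding soft_ramp_def[abs_def] by (rule DERIV_mult[OF DERIV_ident DERIV_flat])
  moreover have "1 * flat 0 t + (flat (0 + 2) t - real 0 * flat (0 + 1) t) * t = flat 0 t + flat 1 t"
    by (simp add: flat_def power2_eq_square)
  ultimately show ?thesis by (simp only:)
qed

text \<open>With y = 1 / t the slope is (1 + y) exp (- y), and 1 + y <= exp y.\<close>

lemma soft_ramp_deriv_bounds: "0 \<le> flat 0 t + flat 1 t" "flat 0 t + flat 1 t \<le> 1"
proof -
  show "0 \<le> flat 0 t + flat 1 t" by (simp add: flat_def)
  show "flat 0 t + flat 1 t \<le> 1"
  proof (cases "0 < t")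
    case True
    have "(1 + 1 / t) * exp (- (1 / t)) \<le> exp (1 / t) * exp (- (1 / t))"
      using exp_ge_add_one_self[of "1 / t"] by (intro mult_right_mono) auto
    also have "\<dots> = 1" by (simp flip: exp_add)
    finally show ?thesis using True by (simp add: flat_def algebra_simps)
  qed (simp add: flat_def)
qed

lemma soft_ramp_bounds: "t - 1 \<le> soft_ramp t" "0 \<le> soft_ramp t" "soft_ramp t \<le> max t 0"
  "t \<le> 0 \<Longrightarrow> soft_ramp t = 0"
proof -
  show "t - 1 \<le> soft_ramp t"
  proof (cases "0 < t")
    case True
    have "t * (1 - 1 / t) \<le> t * exp (- (1 / t))"
      using exp_ge_add_one_self[of "- (1 / t)"] True by (intro mult_left_mono) auto
    then show ?thesis using True by (simp add: soft_ramp_def flat_def algebra_simps)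
  qed (simp add: soft_ramp_def flat_def)
  show "soft_ramp t \<le> max t 0"
    by (auto simp: soft_ramp_def flat_def mult_le_cancel_left1)
qed (auto simp: soft_ramp_def flat_def)

lemma times_differentiable_soft_ramp: "times_differentiable k soft_ramp"
  unfolding soft_ramp_def[abs_def]
  by (intro times_differentiable_mult times_differentiable_id times_differentiable_flat)

lemma times_differentiable_sl: "times_differentiable k sl"
proof -
  have "times_differentiable k sl \<and> times_differentiable k sl'"
  proof (induction k)
    case (Suc k)
    then have "times_differentiable k (\<lambda>x. - 2 * sl x ^ 3)"
      by (intro times_differentiable_mult times_differentiable_const times_differentiable_power) auto
    then show ?case
      using times_differentiable_SucI[OF DERIV_sl] times_differentiable_SucI[OF DERIV_sl'] Suc by blast
  qed simp
  then show ?thesis ..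
qed

lemma times_differentiable_sl_wave: "times_differentiable k (sl_wave c)"
  unfolding sl_wave_def[abs_def]
  by (intro times_differentiable_mult times_differentiable_const times_differentiable_add times_differentiable_id
      times_differentiable_compose[OF times_differentiable_sl])

section \<open>Truncations of the wave\<close>

text \<open>A smooth version of the positive part of W - \<epsilon>: the factors \<epsilon> and 1 /
  \<epsilon> cancel in the slope, and the function vanishes where W <= \<epsilon>, in particular
  near the end points. The cutoff outside the interval matters because the wave is periodic and
  becomes positive again. The argument is written with a product and a sum to match the
  differentiability rules.\<close>

definition truncated_wave :: "real \<Rightarrow> real \<Rightarrow> real" where
  "truncated_wave \<epsilon> x = (if x \<in> II_closed then \<epsilon> * soft_ramp (sl_wave A3 x * (1 / \<epsilon>) + - 1) else 0)"

lemma truncated_wave_test_function: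
  assumes "0 < \<epsilon>"
  shows "truncated_wave \<epsilon> \<in> test_functions"
  unfolding truncated_wave_def[abs_def]
proof (rule test_function_cutoff)
  show "open {x. sl_wave A3 x < \<epsilon>}"
    by (intro open_Collect_less continuous_intros)
  show "times_differentiable k (\<lambda>x. \<epsilon> * soft_ramp (sl_wave A3 x * (1 / \<epsilon>) + - 1))" for k
    by (intro times_differentiable_mult times_differentiable_const times_differentiable_add
        times_differentiable_sl_wave times_differentiable_compose[OF times_differentiable_soft_ramp])
  show "\<epsilon> * soft_ramp (sl_wave A3 x * (1 / \<epsilon>) + - 1) = 0" if "x \<in> {x. sl_wave A3 x < \<epsilon>}" for x
    using that assms by (simp add: soft_ramp_bounds(4) less_imp_le)
qed (use assms sl_wave_A3 in auto)

text \<open>The chain rule multiplies the slope of W by a factor in [0, 1]. For the infimum this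
  upper bound takes the place of convergence of the derivatives.\<close>

lemma truncated_wave_deriv_norm:
  assumes "0 < \<epsilon>"
  shows "(L2norm (deriv (truncated_wave \<epsilon>)))\<^sup>2 \<le> 4 * A3 ^ 3 * B3"
proof -
  have d: "\<bar>deriv (truncated_wave \<epsilon>) x\<bar> \<le> \<bar>sl_wave' A3 x\<bar>" if "x \<in> II" for x
  proof -
    let ?f = "\<lambda>x. \<epsilon> * soft_ramp (sl_wave A3 x * (1 / \<epsilon>) + - 1)"
    let ?t = "sl_wave A3 x * (1 / \<epsilon>) + - 1"
    have "((\<lambda>x. sl_wave A3 x * (1 / \<epsilon>) + - 1) has_real_derivative sl_wave' A3 x * (1 / \<epsilon>)) (at x)"
      using assms by (auto intro!: derivative_eq_intros DERIV_sl_wave)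
    then have "(?f has_real_derivative \<epsilon> * ((flat 0 ?t + flat 1 ?t) * (sl_wave' A3 x * (1 / \<epsilon>)))) (at x)"
      by (intro DERIV_cmult DERIV_chain2[OF DERIV_soft_ramp])
    moreover have "deriv (truncated_wave \<epsilon>) x = deriv ?f x"
      by (rule deriv_cong_II[OF _ that]) (auto simp: truncated_wave_def)
    ultimately have "deriv (truncated_wave \<epsilon>) x = (flat 0 ?t + flat 1 ?t) * sl_wave' A3 x"
      using assms by (simp add: DERIV_imp_deriv)
    moreover have "\<bar>flat 0 ?t + flat 1 ?t\<bar> * \<bar>sl_wave' A3 x\<bar> \<le> 1 * \<bar>sl_wave' A3 x\<bar>"
      using soft_ramp_deriv_bounds[of ?t] by (intro mult_right_mono) auto
    ultimately show ?thesis by (simp add: abs_mult)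
  qed
  have c: "continuous_on S (deriv (truncated_wave \<epsilon>))" for S
    by (intro test_function_continuous test_function_deriv truncated_wave_test_function assms)
  have "(L2norm (deriv (truncated_wave \<epsilon>)))\<^sup>2 \<le> integral\<^sup>L (lebesgue_on II) (\<lambda>x. (sl_wave' A3 x)\<^sup>2)"
    unfolding L2norm_squared
    by (intro integral_mono integrable_II continuous_intros c) (use d in \<open>auto simp: abs_le_square_iff\<close>)
  also have "\<dots> = integral II_closed (\<lambda>x. (sl_wave' A3 x)\<^sup>2)" by (intro integral_II continuous_intros)
  also have "\<dots> = 4 * A3 ^ 3 * B3" by (intro integral_unique has_integral_sl_wave_A3)
  finally show ?thesis .
qed

text \<open>The truncation lies between W - 2 \<epsilon> and W: one \<epsilon> is the shift, the
  other the gap between the soft ramp and the identity. The fourth power of W dominates.\<close>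

lemma truncated_wave_integral_limit:
  "(\<lambda>n. integral\<^sup>L (lebesgue_on II) (\<lambda>x. truncated_wave (1 / real (Suc n)) x ^ 4)) \<longlonglongrightarrow> 4 * A3 ^ 3 * B3"
proof -
  define \<epsilon> where "\<epsilon> n = 1 / real (Suc n)" for n
  have pos: "0 < \<epsilon> n" for n by (simp add: \<epsilon>_def)
  have lim: "\<epsilon> \<longlonglongrightarrow> 0" using LIMSEQ_inverse_real_of_nat by (simp add: \<epsilon>_def[abs_def] inverse_eq_divide)
  have b: "sl_wave A3 x - 2 * \<epsilon> n \<le> truncated_wave (\<epsilon> n) x" "0 \<le> truncated_wave (\<epsilon> n) x"
    "truncated_wave (\<epsilon> n) x \<le> sl_wave A3 x" if "x \<in> II" for x n
  proof -
    let ?t = "sl_wave A3 x * (1 / \<epsilon> n) + - 1"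
    have eq: "truncated_wave (\<epsilon> n) x = \<epsilon> n * soft_ramp ?t" using that by (simp add: truncated_wave_def)
    have "\<epsilon> n * (?t - 1) \<le> \<epsilon> n * soft_ramp ?t"
      using pos[of n] soft_ramp_bounds(1)[of ?t] by (intro mult_left_mono) auto
    then show "sl_wave A3 x - 2 * \<epsilon> n \<le> truncated_wave (\<epsilon> n) x"
      unfolding eq using pos[of n] by (simp add: algebra_simps)
    show "0 \<le> truncated_wave (\<epsilon> n) x"
      unfolding eq using pos[of n] soft_ramp_bounds(2)[of ?t] by simp
    have "\<epsilon> n * soft_ramp ?t \<le> \<epsilon> n * max ?t 0"
      using pos[of n] soft_ramp_bounds(3)[of ?t] by (intro mult_left_mono) auto
    also have "\<dots> \<le> sl_wave A3 x"
      using pos[of n] sl_wave_A3(4)[OF that] by (auto simp: max_def algebra_simps)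
    finally show "truncated_wave (\<epsilon> n) x \<le> sl_wave A3 x" unfolding eq .
  qed
  have "(\<lambda>n. integral\<^sup>L (lebesgue_on II) (\<lambda>x. truncated_wave (\<epsilon> n) x ^ 4))
      \<longlonglongrightarrow> integral\<^sup>L (lebesgue_on II) (\<lambda>x. sl_wave A3 x ^ 4)"
  proof (rule integral_dominated_convergence)
    show i: "integrable (lebesgue_on II) (\<lambda>x. sl_wave A3 x ^ 4)"
      by (intro integrable_II continuous_intros)
    then show "(\<lambda>x. sl_wave A3 x ^ 4) \<in> borel_measurable (lebesgue_on II)" by auto
    show "(\<lambda>x. truncated_wave (\<epsilon> n) x ^ 4) \<in> borel_measurable (lebesgue_on II)" for n
      by (intro borel_measurable_integrable integrable_II continuous_intros test_function_continuous
          truncated_wave_test_function pos)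
    show "AE x in lebesgue_on II. norm (truncated_wave (\<epsilon> n) x ^ 4) \<le> sl_wave A3 x ^ 4" for n
      using b(2,3) by (intro AE_I2) (auto intro!: power_mono)
    show "AE x in lebesgue_on II. (\<lambda>n. truncated_wave (\<epsilon> n) x ^ 4) \<longlonglongrightarrow> sl_wave A3 x ^ 4"
    proof (intro AE_I2 tendsto_power)
      fix x assume "x \<in> space (lebesgue_on II)"
      then have x: "x \<in> II" by simp
      have "(\<lambda>n. sl_wave A3 x - 2 * \<epsilon> n) \<longlonglongrightarrow> sl_wave A3 x - 2 * 0" by (intro tendsto_intros lim)
      then have L: "(\<lambda>n. sl_wave A3 x - 2 * \<epsilon> n) \<longlonglongrightarrow> sl_wave A3 x" by simp
      show "(\<lambda>n. truncated_wave (\<epsilon> n) x) \<longlonglongrightarrow> sl_wave A3 x"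
        by (rule tendsto_sandwich[OF _ _ L tendsto_const]) (simp_all add: b[OF x])
    qed
  qed
  also have "integral\<^sup>L (lebesgue_on II) (\<lambda>x. sl_wave A3 x ^ 4) = integral II_closed (\<lambda>x. sl_wave A3 x ^ 4)"
    by (intro integral_II continuous_intros)
  also have "\<dots> = 4 * A3 ^ 3 * B3" by (intro integral_unique has_integral_sl_wave_A3)
  finally show ?thesis unfolding \<epsilon>_def .
qed

text \<open>The quotient is invariant under multiples of the test function; the multiple Q^(-1/4)
  meets the constraint.\<close>

lemma normalized_test_function:
  assumes "\<phi> \<in> test_functions" and Q: "0 < integral\<^sup>L (lebesgue_on II) (\<lambda>x. \<phi> x ^ 4)" (is "0 < ?Q")
  shows "L2norm (deriv \<phi>) ^ 4 / ?Q \<in> {L2norm g ^ 4 |u g. u \<in> H01 \<and> has_weak_deriv u g \<and>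
                integral\<^sup>L (lebesgue_on II) (\<lambda>x. u x ^ 4) = 1}"
proof -
  define c where "c = 1 / sqrt (sqrt ?Q)"
  have c4: "c ^ 4 = 1 / ?Q"
  proof -
    have "sqrt (sqrt ?Q) ^ 4 = ((sqrt (sqrt ?Q))\<^sup>2)\<^sup>2" by (simp only: power_mult[symmetric]) simp
    also have "\<dots> = ?Q" using Q by (simp del: real_sqrt_power)
    finally show ?thesis by (simp add: c_def power_divide del: real_sqrt_power)
  qed
  let ?u = "\<lambda>x. c * \<phi> x"
  have u: "?u \<in> test_functions" by (rule test_function_cmult[OF assms(1)])
  have "deriv ?u = (\<lambda>x. c * deriv \<phi> x)"
    using test_function_DERIV[OF assms(1)] by (auto intro!: DERIV_imp_deriv DERIV_cmult)
  then have n2: "(L2norm (deriv ?u))\<^sup>2 = c\<^sup>2 * (L2norm (deriv \<phi>))\<^sup>2"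
    by (simp add: L2norm_squared power_mult_distrib)
  have sq: "y ^ 4 = (y\<^sup>2)\<^sup>2" for y :: real by (simp flip: power_mult)
  have "L2norm (deriv ?u) ^ 4 = c ^ 4 * L2norm (deriv \<phi>) ^ 4"
    by (simp only: sq n2 power_mult_distrib)
  then have "L2norm (deriv ?u) ^ 4 = L2norm (deriv \<phi>) ^ 4 / ?Q" by (simp add: c4)
  moreover have "integral\<^sup>L (lebesgue_on II) (\<lambda>x. ?u x ^ 4) = 1"
    using Q by (simp add: power_mult_distrib c4)
  ultimately show ?thesis
    using test_function_H01[OF u] test_function_weak_deriv[OF u]
    by (intro CollectI exI[of _ "deriv ?u"] exI[of _ ?u]) simp
qed

section \<open>The solution branches\<close>

lemma mu1_eq: "mu1 = 4 * A3 ^ 3 * B3"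
proof -
  define K where "K = 4 * A3 ^ 3 * B3"
  have "0 < K" using A3_pos B3_eq by (simp add: K_def)
  let ?S = "{L2norm g ^ 4 |u g. u \<in> H01 \<and> has_weak_deriv u g \<and>
                integral\<^sup>L (lebesgue_on II) (\<lambda>x. u x ^ 4) = 1}"
  define \<phi> where "\<phi> n = truncated_wave (1 / real (Suc n))" for n
  define Q where "Q n = integral\<^sup>L (lebesgue_on II) (\<lambda>x. \<phi> n x ^ 4)" for n
  have \<phi>: "\<phi> n \<in> test_functions" "(L2norm (deriv (\<phi> n)))\<^sup>2 \<le> K" for n
    unfolding \<phi>_def K_def by (intro truncated_wave_test_function truncated_wave_deriv_norm; simp)+
  have Q: "Q \<longlonglongrightarrow> K"
    using truncated_wave_integral_limit by (simp add: Q_def[abs_def] \<phi>_def K_def)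
  have lower: "K \<le> y" if "y \<in> ?S" for y
    using that H01_sharp_ineq by (auto simp: K_def)
  have mem: "L2norm (deriv (\<phi> n)) ^ 4 / Q n \<in> ?S" if "0 < Q n" for n
    using normalized_test_function[OF \<phi>(1), of n] that unfolding Q_def by blast
  have pos: "\<forall>\<^sub>F n in sequentially. 0 < Q n" by (rule order_tendstoD(1)[OF Q \<open>0 < K\<close>])
  \<comment> \<open>The numerator is bounded by K^2 and Q n tends to K, so these upper bounds tend
    to K.\<close>
  have "mu1 \<le> K\<^sup>2 / Q n" if "0 < Q n" for n
  proof -
    have "mu1 \<le> L2norm (deriv (\<phi> n)) ^ 4 / Q n"
      unfolding mu1_def by (rule cInf_lower[OF mem[OF that]]) (use lower in \<open>auto intro!: bdd_belowI[where m = K]\<close>)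
    also have "\<dots> \<le> K\<^sup>2 / Q n"
    proof (rule divide_right_mono)
      have "((L2norm (deriv (\<phi> n)))\<^sup>2)\<^sup>2 \<le> K\<^sup>2" by (intro power_mono \<phi>(2)) simp
      then show "L2norm (deriv (\<phi> n)) ^ 4 \<le> K\<^sup>2" by (simp flip: power_mult)
    qed (use that in simp)
    finally show ?thesis .
  qed
  with pos have "\<forall>\<^sub>F n in sequentially. mu1 \<le> K\<^sup>2 / Q n" by (auto elim: eventually_mono)
  moreover have "(\<lambda>n. K\<^sup>2 / Q n) \<longlonglongrightarrow> K\<^sup>2 / K" using \<open>0 < K\<close> by (intro tendsto_intros Q) auto
  ultimately have "mu1 \<le> K\<^sup>2 / K" by (intro tendsto_lowerbound[of _ "K\<^sup>2 / K"]) auto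
  moreover have "?S \<noteq> {}" using eventually_happens[OF pos] mem by fastforce
  then have "K \<le> mu1" unfolding mu1_def using lower by (rule cInf_greatest)
  moreover have "K\<^sup>2 / K = K" by (simp add: power2_eq_square)
  ultimately show ?thesis by (simp add: K_def)
qed

lemma L2norm_deriv_W3: "L2norm (deriv W3) = 2 * A3 powr (3/2) * B3 powr (1/2)"
proof (rule power2_eq_imp_eq)
  have "0 < B3" using B3_eq A3_pos by simp
  have "(A3 powr (3/2))\<^sup>2 = A3 ^ 3"
    using A3_pos by (simp add: power2_eq_square flip: powr_add)
  moreover have "(B3 powr (1/2))\<^sup>2 = B3"
    using \<open>0 < B3\<close> by (simp add: power2_eq_square flip: powr_add)
  ultimately show "(L2norm (deriv W3))\<^sup>2 = (2 * A3 powr (3/2) * B3 powr (1/2))\<^sup>2"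
    by (simp add: deriv_W3_norm power_mult_distrib)
qed (auto simp: L2norm_def)

lemma maxnorm_scaled:
  assumes "\<And>x. x \<in> II_closed \<Longrightarrow> u x = c * f x" "0 \<le> c"
    and "\<And>x. x \<in> II_closed \<Longrightarrow> \<bar>f x\<bar> \<le> f 0"
  shows "maxnorm u = c * f 0"
proof (rule maxnorm_eqI[of u "c * f 0" 0])
  show "\<bar>u x\<bar> \<le> c * f 0" if "x \<in> II_closed" for x
    using assms(3)[OF that] assms(2) by (simp add: assms(1)[OF that] abs_mult mult_left_mono)
  show "\<bar>u 0\<bar> = c * f 0"
    using assms(3)[of 0] assms(2) by (simp add: assms(1) abs_mult)
qed simp

text \<open>Each branch formula is an equivalence: the unique solution is an explicit positive
  multiple c of a profile whose maximum is at 0, so the condition on the maximum norm is an equation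
  for c, solved for \<open>lam\<close>.\<close>

theorem theorem1p7:
  fixes a b :: real
  assumes "a > 0" and "b > 0"
  shows
    "(a * mu1 = 4 * a * A3 ^ 3 * B3 \<and>
     L2norm (deriv W3) = 2 * A3 powr (3/2) * B3 powr (1/2) \<and>
     (\<forall>lam > a * mu1.
        (let u = (\<lambda>x. sqrt (b * (L2norm (deriv W3))\<^sup>2 / (lam - a * (L2norm (deriv W3))\<^sup>2))
                      * inverse (L2norm (deriv W3)) * W3 x) in
           kirchhoff_solution a b 3 lam u \<and>
           (\<forall>v. kirchhoff_solution a b 3 lam v \<longrightarrow> (\<forall>x\<in>II_closed. v x = u x))) \<and>
        (\<forall>\<xi>>0. (\<exists>u. kirchhoff_solution a b 3 lam u \<and> maxnorm u = \<xi>) \<longleftrightarrow>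
               lam = 4 * a * A3 ^ 3 * B3 + 2 * A3\<^sup>2 * b / \<xi>\<^sup>2))) \<and>
     (\<forall>lam > pi\<^sup>2 / 4 * b.
        (let u = (\<lambda>x. 4 / pi\<^sup>2 * sqrt ((lam - pi\<^sup>2 * b / 4) / a) * cos (pi / 2 * x)) in
           kirchhoff_solution a b 1 lam u \<and>
           (\<forall>v. kirchhoff_solution a b 1 lam v \<longrightarrow> (\<forall>x\<in>II_closed. v x = u x))) \<and>
        (\<forall>\<xi>>0. (\<exists>u. kirchhoff_solution a b 1 lam u \<and> maxnorm u = \<xi>) \<longleftrightarrow>
               lam = pi ^ 4 / 16 * a * \<xi>\<^sup>2 + pi\<^sup>2 / 4 * b))"
proof (intro conjI allI impI)
  show mu: "a * mu1 = 4 * a * A3 ^ 3 * B3" by (simp add: mu1_eq)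
  show "L2norm (deriv W3) = 2 * A3 powr (3/2) * B3 powr (1/2)" by (rule L2norm_deriv_W3)
  fix lam assume "a * mu1 < lam"
  then have lam: "4 * a * A3 ^ 3 * B3 < lam" by (simp only: mu)
  define c where "c = sqrt (b / (lam - 4 * a * A3 ^ 3 * B3))"
  have c: "0 < c" "c\<^sup>2 = b / (lam - 4 * a * A3 ^ 3 * B3)" using lam assms by (auto simp: c_def)
  note sol = kirchhoff_cubic_iff[OF assms lam, folded c_def]
  have "0 < (L2norm (deriv W3))\<^sup>2" using A3_pos B3_eq by (simp add: deriv_W3_norm)
  then have N: "0 < L2norm (deriv W3)" using L2norm_nonneg[of "deriv W3"] by (auto simp: less_le)
  have "b * (L2norm (deriv W3))\<^sup>2 / (lam - a * (L2norm (deriv W3))\<^sup>2)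
      = b / (lam - 4 * a * A3 ^ 3 * B3) * (L2norm (deriv W3))\<^sup>2"
    by (simp add: deriv_W3_norm mult_ac)
  then have "sqrt (b * (L2norm (deriv W3))\<^sup>2 / (lam - a * (L2norm (deriv W3))\<^sup>2)) = c * L2norm (deriv W3)"
    using N by (simp only: real_sqrt_mult c_def real_sqrt_abs abs_of_pos)
  then have "sqrt (b * (L2norm (deriv W3))\<^sup>2 / (lam - a * (L2norm (deriv W3))\<^sup>2))
      * inverse (L2norm (deriv W3)) = c"
    using N by simp
  then show "let u = (\<lambda>x. sqrt (b * (L2norm (deriv W3))\<^sup>2 / (lam - a * (L2norm (deriv W3))\<^sup>2))
                      * inverse (L2norm (deriv W3)) * W3 x) in
           kirchhoff_solution a b 3 lam u \<and>
           (\<forall>v. kirchhoff_solution a b 3 lam v \<longrightarrow> (\<forall>x\<in>II_closed. v x = u x))"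
    by (simp only: Let_def sol) (simp add: W3_eq)
  fix \<xi> :: real assume \<xi>: "0 < \<xi>"
  have "maxnorm u = c * sl_wave A3 0" if "kirchhoff_solution a b 3 lam u" for u
    by (rule maxnorm_scaled) (use that sol c(1) sl_wave_A3(3,5) in auto)
  moreover have "kirchhoff_solution a b 3 lam (\<lambda>x. c * sl_wave A3 x)" by (simp add: sol)
  ultimately have "(\<exists>u. kirchhoff_solution a b 3 lam u \<and> maxnorm u = \<xi>) \<longleftrightarrow> c * (sqrt 2 * A3) = \<xi>"
    by (auto simp: sl_wave_A3(3))
  \<comment> \<open>Both sides are positive, so squaring loses nothing.\<close>
  also have "\<dots> \<longleftrightarrow> (c * (sqrt 2 * A3))\<^sup>2 = \<xi>\<^sup>2"
    using c(1) A3_pos \<xi> by (simp add: power2_eq_iff_nonneg)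
  also have "\<dots> \<longleftrightarrow> 2 * A3\<^sup>2 * b / (lam - 4 * a * A3 ^ 3 * B3) = \<xi>\<^sup>2"
    by (simp add: power_mult_distrib c(2) mult_ac)
  also have "\<dots> \<longleftrightarrow> lam - 4 * a * A3 ^ 3 * B3 = 2 * A3\<^sup>2 * b / \<xi>\<^sup>2"
    using \<xi> lam by (auto simp: field_simps)
  also have "\<dots> \<longleftrightarrow> lam = 4 * a * A3 ^ 3 * B3 + 2 * A3\<^sup>2 * b / \<xi>\<^sup>2" by linarith
  finally show "(\<exists>u. kirchhoff_solution a b 3 lam u \<and> maxnorm u = \<xi>) \<longleftrightarrow>
      lam = 4 * a * A3 ^ 3 * B3 + 2 * A3\<^sup>2 * b / \<xi>\<^sup>2" .
next
  fix lam assume lam: "pi\<^sup>2 / 4 * b < lam"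
  define c where "c = 4 / pi\<^sup>2 * sqrt ((lam - pi\<^sup>2 * b / 4) / a)"
  have p: "0 < (lam - pi\<^sup>2 * b / 4) / a" using lam assms by simp
  then have c: "0 < c" by (simp add: c_def)
  have c2: "c\<^sup>2 = (4 / pi\<^sup>2)\<^sup>2 * ((lam - pi\<^sup>2 * b / 4) / a)"
    unfolding c_def power_mult_distrib real_sqrt_pow2[OF less_imp_le[OF p]] ..
  note sol = kirchhoff_linear_iff[OF assms lam, folded c_def]
  show "let u = (\<lambda>x. 4 / pi\<^sup>2 * sqrt ((lam - pi\<^sup>2 * b / 4) / a) * cos (pi / 2 * x)) in
           kirchhoff_solution a b 1 lam u \<and>
           (\<forall>v. kirchhoff_solution a b 1 lam v \<longrightarrow> (\<forall>x\<in>II_closed. v x = u x))"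
    unfolding c_def[symmetric] Let_def sol by simp
  fix \<xi> :: real assume \<xi>: "0 < \<xi>"
  have "maxnorm u = c * cos (pi / 2 * 0)" if "kirchhoff_solution a b 1 lam u" for u
    by (rule maxnorm_scaled) (use that sol c in auto)
  moreover have "kirchhoff_solution a b 1 lam (\<lambda>x. c * cos (pi / 2 * x))" by (simp only: sol) simp
  ultimately have "(\<exists>u. kirchhoff_solution a b 1 lam u \<and> maxnorm u = \<xi>) \<longleftrightarrow> c = \<xi>" by auto
  also have "\<dots> \<longleftrightarrow> c\<^sup>2 = \<xi>\<^sup>2"
    using c \<xi> by (simp add: power2_eq_iff_nonneg)
  also have "\<dots> \<longleftrightarrow> lam - pi\<^sup>2 * b / 4 = pi ^ 4 / 16 * a * \<xi>\<^sup>2"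
    using assms unfolding c2 power_divide
    by (simp add: nonzero_divide_eq_eq nonzero_eq_divide_eq mult_ac flip: power_mult)
  also have "\<dots> \<longleftrightarrow> lam = pi ^ 4 / 16 * a * \<xi>\<^sup>2 + pi\<^sup>2 / 4 * b" by (auto simp: field_simps)
  finally show "(\<exists>u. kirchhoff_solution a b 1 lam u \<and> maxnorm u = \<xi>) \<longleftrightarrow>
      lam = pi ^ 4 / 16 * a * \<xi>\<^sup>2 + pi\<^sup>2 / 4 * b" .
qed

end
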